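(* Let $\perp$ be a ternary relation between small subsets of the big model that satisfies invariance, monotonicity and the strong finite character condition. Then the relation $\perp^*$ defined by $$A\perp^*_C B \iff \text{for all } \hat B\supseteq B \text{ there is } A'\equiv_{BC}A \text{ such that } A'\perp_C\hat B$$ also satisfies the strong finite character condition.
   Context: $T$ is a complete consistent first-order theory (possibly many-sorted); we work in a big saturated model of $T$. All sets $A,B,C,\dots$ are small subsets of the big model; $BC$ means $B\cup C$. A tuple is also used to denote the set of its entries, and $\bar a\in A$ means that all entries of $\bar a$ lie in $A$. $A\equiv_B A'$ means that some automorphism of the big model fixing $B$ pointwise maps the set $A$ onto the set $A'$; $(A,B,C)\equiv(A',B',C')$ means that some automorphism maps $A$ onto $A'$, $B$ onto $B'$ and $C$ onto $C'$. Properties of a ternary relation $\perp$ (with $\not\perp$ its negation): - (invariance) If $A\perp_CB$ and $(A',B',C')\equiv(A,B,C)$, then $A'\perp_{C'}B'$. - (monotonicity) If $A\perp_CB$, $A'\subseteq A$ and $B'\subseteq B$, then $A'\perp_CB'$. - (strong finite character) If $A\not\perp_CB$, then there are finite tuples $\bar a\in A$, $\bar b\in B$, $\bar c\in C$ and a formula $\varphi(\bar x,\bar y,\bar z)$ without parameters such that $\models\varphi(\bar a,\bar b,\bar c)$, and $\bar a'\not\perp_C\bar b$ for all $\bar a'$ satisfying $\models\varphi(\bar a',\bar b,\bar c)$. *)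

theory Defs
  imports Main
begin

unbundle cardinal_syntax

section \<open>Many-sorted first-order logic with equality\<close>

text \<open>A variable is a name together with its sort, so there are countably many variables of
  each sort. Symbol sets are explicit sets rather than whole types, since HOL types cannot be
  empty but a language may well lack, say, function symbols. Constants are function symbols
  without arguments.\<close>

type_synonym 's vbl = "nat \<times> 's"

datatype ('s, 'f) tm =
    Var "'s vbl"
  | Fun 'f "('s, 'f) tm list"

datatype ('s, 'f, 'p) fm =
    Falsum
  | Eq "('s, 'f) tm" "('s, 'f) tm"
  | Rel 'p "('s, 'f) tm list"
  | Imp "('s, 'f, 'p) fm" "('s, 'f, 'p) fm"
  | All "'s vbl" "('s, 'f, 'p) fm"

abbreviation Neg :: "('s, 'f, 'p) fm \<Rightarrow> ('s, 'f, 'p) fm" where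
  "Neg \<phi> \<equiv> Imp \<phi> Falsum"

record ('s, 'f, 'p) lang =
  sorts :: "'s set"
  fsyms :: "'f set"
  psyms :: "'p set"
  fargs :: "'f \<Rightarrow> 's list"
  fres :: "'f \<Rightarrow> 's"
  pargs :: "'p \<Rightarrow> 's list"

definition is_lang :: "('s, 'f, 'p) lang \<Rightarrow> bool" where
  "is_lang L \<longleftrightarrow>
    (\<forall>f\<in>fsyms L. set (fargs L f) \<subseteq> sorts L \<and> fres L f \<in> sorts L) \<and>
    (\<forall>P\<in>psyms L. set (pargs L P) \<subseteq> sorts L)"

fun tm_sort :: "('s, 'f, 'p) lang \<Rightarrow> ('s, 'f) tm \<Rightarrow> 's" where
  "tm_sort L (Var v) = snd v"
| "tm_sort L (Fun f ts) = fres L f"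

primrec wf_tm :: "('s, 'f, 'p) lang \<Rightarrow> ('s, 'f) tm \<Rightarrow> bool" where
  "wf_tm L (Var v) \<longleftrightarrow> snd v \<in> sorts L"
| "wf_tm L (Fun f ts) \<longleftrightarrow>
    f \<in> fsyms L \<and> list_all (wf_tm L) ts \<and> map (tm_sort L) ts = fargs L f"

primrec wf_fm :: "('s, 'f, 'p) lang \<Rightarrow> ('s, 'f, 'p) fm \<Rightarrow> bool" where
  "wf_fm L Falsum \<longleftrightarrow> True"
| "wf_fm L (Eq t u) \<longleftrightarrow> wf_tm L t \<and> wf_tm L u \<and> tm_sort L t = tm_sort L u"
| "wf_fm L (Rel P ts) \<longleftrightarrow>
    P \<in> psyms L \<and> list_all (wf_tm L) ts \<and> map (tm_sort L) ts = pargs L P"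
| "wf_fm L (Imp \<phi> \<psi>) \<longleftrightarrow> wf_fm L \<phi> \<and> wf_fm L \<psi>"
| "wf_fm L (All v \<phi>) \<longleftrightarrow> snd v \<in> sorts L \<and> wf_fm L \<phi>"

primrec tm_vars :: "('s, 'f) tm \<Rightarrow> 's vbl set" where
  "tm_vars (Var v) = {v}"
| "tm_vars (Fun f ts) = \<Union> (set (map tm_vars ts))"

primrec fv :: "('s, 'f, 'p) fm \<Rightarrow> 's vbl set" where
  "fv Falsum = {}"
| "fv (Eq t u) = tm_vars t \<union> tm_vars u"
| "fv (Rel P ts) = \<Union> (set (map tm_vars ts))"
| "fv (Imp \<phi> \<psi>) = fv \<phi> \<union> fv \<psi>"
| "fv (All v \<phi>) = fv \<phi> - {v}"

definition is_sentence :: "('s, 'f, 'p) lang \<Rightarrow> ('s, 'f, 'p) fm \<Rightarrow> bool" where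
  "is_sentence L \<phi> \<longleftrightarrow> wf_fm L \<phi> \<and> fv \<phi> = {}"

text \<open>The universe of a structure is the disjoint union of its sorts, the sort of an element
  being recorded by \<open>sort_of\<close>; thus subsets of a structure may contain elements of different
  sorts. All sorts are nonempty.\<close>

record ('s, 'f, 'p, 'a) struct =
  univ :: "'a set"
  sort_of :: "'a \<Rightarrow> 's"
  fint :: "'f \<Rightarrow> 'a list \<Rightarrow> 'a"
  pint :: "'p \<Rightarrow> 'a list \<Rightarrow> bool"

definition is_struct :: "('s, 'f, 'p) lang \<Rightarrow> ('s, 'f, 'p, 'a) struct \<Rightarrow> bool" where
  "is_struct L M \<longleftrightarrow>
    sort_of M ` univ M = sorts L \<and>
    (\<forall>f\<in>fsyms L. \<forall>as. set as \<subseteq> univ M \<and> map (sort_of M) as = fargs L f \<longrightarrow>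
      fint M f as \<in> univ M \<and> sort_of M (fint M f as) = fres L f)"

primrec eval :: "('s, 'f, 'p, 'a) struct \<Rightarrow> ('s vbl \<Rightarrow> 'a) \<Rightarrow> ('s, 'f) tm \<Rightarrow> 'a" where
  "eval M e (Var v) = e v"
| "eval M e (Fun f ts) = fint M f (map (eval M e) ts)"

primrec sat :: "('s, 'f, 'p, 'a) struct \<Rightarrow> ('s vbl \<Rightarrow> 'a) \<Rightarrow> ('s, 'f, 'p) fm \<Rightarrow> bool" where
  "sat M e Falsum \<longleftrightarrow> False"
| "sat M e (Eq t u) \<longleftrightarrow> eval M e t = eval M e u"
| "sat M e (Rel P ts) \<longleftrightarrow> pint M P (map (eval M e) ts)"
| "sat M e (Imp \<phi> \<psi>) \<longleftrightarrow> (sat M e \<phi> \<longrightarrow> sat M e \<psi>)"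
| "sat M e (All v \<phi>) \<longleftrightarrow>
    (\<forall>a\<in>univ M. sort_of M a = snd v \<longrightarrow> sat M (e(v := a)) \<phi>)"

definition is_model :: "('s, 'f, 'p) lang \<Rightarrow> ('s, 'f, 'p, 'a) struct \<Rightarrow> ('s, 'f, 'p) fm set \<Rightarrow> bool"
  where "is_model L M T \<longleftrightarrow> is_struct L M \<and> (\<forall>\<phi>\<in>T. \<forall>e. sat M e \<phi>)"

text \<open>HOL does not allow quantification over all types of elements. The type of formulas is
  infinite and at least as large as the language, so by the downward Loewenheim-Skolem theorem
  a set of sentences with a model has one whose universe is a set of formulas. Hence the
  following is logical consequence with respect to arbitrary models.\<close>

definition entails :: "('s, 'f, 'p) lang \<Rightarrow> ('s, 'f, 'p) fm set \<Rightarrow> ('s, 'f, 'p) fm \<Rightarrow> bool" where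
  "entails L T \<phi> \<longleftrightarrow>
    (\<forall>N :: ('s, 'f, 'p, ('s, 'f, 'p) fm) struct. is_model L N T \<longrightarrow> (\<forall>e. sat N e \<phi>))"

definition is_theory :: "('s, 'f, 'p) lang \<Rightarrow> ('s, 'f, 'p) fm set \<Rightarrow> bool" where
  "is_theory L T \<longleftrightarrow> (\<forall>\<phi>\<in>T. is_sentence L \<phi>)"

definition consistent :: "('s, 'f, 'p) lang \<Rightarrow> ('s, 'f, 'p) fm set \<Rightarrow> bool" where
  "consistent L T \<longleftrightarrow> \<not> entails L T Falsum"

definition complete :: "('s, 'f, 'p) lang \<Rightarrow> ('s, 'f, 'p) fm set \<Rightarrow> bool" where
  "complete L T \<longleftrightarrow> (\<forall>\<phi>. is_sentence L \<phi> \<longrightarrow> entails L T \<phi> \<or> entails L T (Neg \<phi>))"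


section \<open>Small sets and saturation\<close>

text \<open>Small means of smaller cardinality than the model. The disjunct \<open>finite A\<close> only matters
  when the model itself is finite; then all of its subsets are small.\<close>

definition small :: "('s, 'f, 'p, 'a) struct \<Rightarrow> 'a set \<Rightarrow> bool" where
  "small M A \<longleftrightarrow> A \<subseteq> univ M \<and> (finite A \<or> |A| <o |univ M| )"

text \<open>A pair \<open>(\<phi>, e)\<close> stands for the formula with parameters obtained from \<open>\<phi>\<close> by
  substituting \<open>e v\<close> for every free variable \<open>v\<close> other than \<open>x\<close>.\<close>

definition fm_over :: "('s, 'f, 'p) lang \<Rightarrow> ('s, 'f, 'p, 'a) struct \<Rightarrow> 's vbl \<Rightarrow> 'a set \<Rightarrow>
    (('s, 'f, 'p) fm \<times> ('s vbl \<Rightarrow> 'a)) set" where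
  "fm_over L M x A =
    {(\<phi>, e). wf_fm L \<phi> \<and> (\<forall>v\<in>fv \<phi> - {x}. e v \<in> A \<and> sort_of M (e v) = snd v)}"

definition realizes :: "('s, 'f, 'p, 'a) struct \<Rightarrow> 's vbl \<Rightarrow> 'a \<Rightarrow>
    (('s, 'f, 'p) fm \<times> ('s vbl \<Rightarrow> 'a)) set \<Rightarrow> bool" where
  "realizes M x a p \<longleftrightarrow>
    a \<in> univ M \<and> sort_of M a = snd x \<and> (\<forall>(\<phi>, e)\<in>p. sat M (e(x := a)) \<phi>)"

definition saturated :: "('s, 'f, 'p) lang \<Rightarrow> ('s, 'f, 'p, 'a) struct \<Rightarrow> bool" where
  "saturated L M \<longleftrightarrow>
    (\<forall>A x p. small M A \<and> snd x \<in> sorts L \<and> p \<subseteq> fm_over L M x A \<and>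
      (\<forall>q. finite q \<and> q \<subseteq> p \<longrightarrow> (\<exists>a. realizes M x a q)) \<longrightarrow> (\<exists>a. realizes M x a p))"


section \<open>Automorphisms\<close>

definition automorphism :: "('s, 'f, 'p) lang \<Rightarrow> ('s, 'f, 'p, 'a) struct \<Rightarrow> ('a \<Rightarrow> 'a) \<Rightarrow> bool"
  where "automorphism L M \<sigma> \<longleftrightarrow>
    bij_betw \<sigma> (univ M) (univ M) \<and>
    (\<forall>a\<in>univ M. sort_of M (\<sigma> a) = sort_of M a) \<and>
    (\<forall>f\<in>fsyms L. \<forall>as. set as \<subseteq> univ M \<and> map (sort_of M) as = fargs L f \<longrightarrow>
      \<sigma> (fint M f as) = fint M f (map \<sigma> as)) \<and>
    (\<forall>P\<in>psyms L. \<forall>as. set as \<subseteq> univ M \<and> map (sort_of M) as = pargs L P \<longrightarrow>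
      (pint M P (map \<sigma> as) \<longleftrightarrow> pint M P as))"

definition equiv_over :: "('s, 'f, 'p) lang \<Rightarrow> ('s, 'f, 'p, 'a) struct \<Rightarrow>
    'a set \<Rightarrow> 'a set \<Rightarrow> 'a set \<Rightarrow> bool" where
  "equiv_over L M B A A' \<longleftrightarrow> (\<exists>\<sigma>. automorphism L M \<sigma> \<and> (\<forall>b\<in>B. \<sigma> b = b) \<and> \<sigma> ` A = A')"

definition equiv_triple :: "('s, 'f, 'p) lang \<Rightarrow> ('s, 'f, 'p, 'a) struct \<Rightarrow>
    'a set \<times> 'a set \<times> 'a set \<Rightarrow> 'a set \<times> 'a set \<times> 'a set \<Rightarrow> bool" where
  "equiv_triple L M = (\<lambda>(A, B, C) (A', B', C').
    \<exists>\<sigma>. automorphism L M \<sigma> \<and> \<sigma> ` A = A' \<and> \<sigma> ` B = B' \<and> \<sigma> ` C = C')"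


section \<open>Ternary relations between small sets\<close>

text \<open>\<open>ind A C B\<close> stands for \<open>A \<bottom>\<^sub>C B\<close>, with the base set as the middle argument. Only the
  values of \<open>ind\<close> at small sets are relevant.\<close>

type_synonym 'a ternary = "'a set \<Rightarrow> 'a set \<Rightarrow> 'a set \<Rightarrow> bool"

definition invariance :: "('s, 'f, 'p) lang \<Rightarrow> ('s, 'f, 'p, 'a) struct \<Rightarrow> 'a ternary \<Rightarrow> bool" where
  "invariance L M ind \<longleftrightarrow>
    (\<forall>A B C A' B' C'. small M A \<and> small M B \<and> small M C \<and>
      small M A' \<and> small M B' \<and> small M C' \<and>
      ind A C B \<and> equiv_triple L M (A', B', C') (A, B, C) \<longrightarrow> ind A' C' B')"

definition monotonicity :: "('s, 'f, 'p, 'a) struct \<Rightarrow> 'a ternary \<Rightarrow> bool" where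
  "monotonicity M ind \<longleftrightarrow>
    (\<forall>A B C A' B'. small M A \<and> small M B \<and> small M C \<and>
      ind A C B \<and> A' \<subseteq> A \<and> B' \<subseteq> B \<longrightarrow> ind A' C B')"

definition tuple_of_sort :: "('s, 'f, 'p, 'a) struct \<Rightarrow> 's vbl list \<Rightarrow> 'a list \<Rightarrow> bool" where
  "tuple_of_sort M vs as \<longleftrightarrow> set as \<subseteq> univ M \<and> map (sort_of M) as = map snd vs"

text \<open>\<open>holds M \<phi> vs as\<close> is the truth of \<open>\<phi>(as)\<close>, where \<open>vs\<close> are distinct variables including
  all free variables of \<open>\<phi>\<close>; the values at other variables are irrelevant.\<close>

definition holds :: "('s, 'f, 'p, 'a) struct \<Rightarrow> ('s, 'f, 'p) fm \<Rightarrow> 's vbl list \<Rightarrow> 'a list \<Rightarrow> bool"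
  where "holds M \<phi> vs as \<longleftrightarrow> sat M (\<lambda>v. the (map_of (zip vs as) v)) \<phi>"

definition strong_finite_character ::
    "('s, 'f, 'p) lang \<Rightarrow> ('s, 'f, 'p, 'a) struct \<Rightarrow> 'a ternary \<Rightarrow> bool" where
  "strong_finite_character L M ind \<longleftrightarrow>
    (\<forall>A B C. small M A \<and> small M B \<and> small M C \<and> \<not> ind A C B \<longrightarrow>
      (\<exists>as bs cs xs ys zs \<phi>.
        set as \<subseteq> A \<and> set bs \<subseteq> B \<and> set cs \<subseteq> C \<and>
        tuple_of_sort M xs as \<and> tuple_of_sort M ys bs \<and> tuple_of_sort M zs cs \<and>
        wf_fm L \<phi> \<and> distinct (xs @ ys @ zs) \<and> fv \<phi> \<subseteq> set (xs @ ys @ zs) \<and>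
        holds M \<phi> (xs @ ys @ zs) (as @ bs @ cs) \<and>
        (\<forall>as'. tuple_of_sort M xs as' \<and> holds M \<phi> (xs @ ys @ zs) (as' @ bs @ cs) \<longrightarrow>
          \<not> ind (set as') C (set bs))))"

definition star :: "('s, 'f, 'p) lang \<Rightarrow> ('s, 'f, 'p, 'a) struct \<Rightarrow> 'a ternary \<Rightarrow> 'a ternary" where
  "star L M ind A C B \<longleftrightarrow>
    (\<forall>B'. small M B' \<and> B \<subseteq> B' \<longrightarrow>
      (\<exists>A'. small M A' \<and> equiv_over L M (B \<union> C) A' A \<and> ind A' C B'))"

end

theory Submission
  imports Defs
begin

text \<open>Let \<open>B'\<close> witness that \<open>A\<close> is not \<open>\<bottom>\<^sup>*\<close>-independent from \<open>B\<close> over \<open>C\<close>. Consider the type of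
  \<open>A\<close> over \<open>B \<union> C\<close> together with the negations of all formulas over \<open>B' \<union> C\<close> that force dependence
  from \<open>B'\<close> over \<open>C\<close>. A realization would be a conjugate of \<open>A\<close> over \<open>B \<union> C\<close>, by homogeneity, and
  independent from \<open>B'\<close> over \<open>C\<close>, by strong finite character; so there is none. By compactness some
  formula \<open>\<phi>\<close> in the type of \<open>A\<close> implies a finite disjunction of formulas that force dependence.
  If \<open>a'\<close> satisfies \<open>\<phi>\<close>, then so do its conjugates over the parameters of \<open>\<phi>\<close>, and by monotonicity
  none of them is independent from \<open>B'\<close> over \<open>C\<close>; thus \<open>B'\<close> also witnesses the dependence of
  \<open>a'\<close>.\<close>

section \<open>Assignments and renaming of variables\<close>

text \<open>Saturation speaks of types in one variable, whereas a copy of the possibly infinite set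
  \<open>A\<close> needs a variable for each of its elements. So compactness for few variables, with
  values prescribed at the parameters, is proved inside \<open>M\<close> itself. It also yields
  homogeneity, since extending an elementary map by one element is the case of at most one free
  index. The size of the language is not bounded, so formulas are never counted, only indices and
  parameters.

  Conditions are predicates on assignments that are definable from finitely many indices, which
  keeps substitution out of the main argument. Elements of \<open>A\<close> and parameters get
  separate indices because an element may be both; the type of \<open>A\<close> then contains the
  equation between its two indices.

  The final tuple must list, besides the elements of \<open>A\<close> needed for
  \<open>\<phi>\<close>, those occurring in the formulas that force dependence, for these are what
  makes \<open>a'\<close> dependent. Moreover, the automorphism that moves \<open>a'\<close> fixes
  only \<open>C\<close> and a finite part of \<open>B\<close>, which is enough because the
  parameters of \<open>\<phi>\<close> are among these.\<close>

abbreviation And :: "('s, 'f, 'p) fm \<Rightarrow> ('s, 'f, 'p) fm \<Rightarrow> ('s, 'f, 'p) fm" where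
  "And \<phi> \<psi> \<equiv> Neg (Imp \<phi> (Neg \<psi>))"

abbreviation Exi :: "'s vbl \<Rightarrow> ('s, 'f, 'p) fm \<Rightarrow> ('s, 'f, 'p) fm" where
  "Exi v \<phi> \<equiv> Neg (All v (Neg \<phi>))"

lemma finite_tm_vars [simp]: "finite (tm_vars t)"
  by (induction t) auto

lemma finite_fv [simp]: "finite (fv \<phi>)"
  by (induction \<phi>) auto

lemma eval_cong: "(\<And>v. v \<in> tm_vars t \<Longrightarrow> e v = e' v) \<Longrightarrow> eval M e t = eval M e' t"
proof (induction t)
  case (Fun f ts)
  then have "map (eval M e) ts = map (eval M e') ts" by auto
  then show ?case by (metis eval.simps(2))
qed auto

lemma sat_cong: "(\<And>v. v \<in> fv \<phi> \<Longrightarrow> e v = e' v) \<Longrightarrow> sat M e \<phi> \<longleftrightarrow> sat M e' \<phi>"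
proof (induction \<phi> arbitrary: e e')
  case (Eq t u)
  then show ?case using eval_cong[of t e e' M] eval_cong[of u e e' M] by auto
next
  case (Rel P ts)
  then have "map (eval M e) ts = map (eval M e') ts" by (auto intro!: eval_cong)
  then show ?case by (metis sat.simps(3))
next
  case (Imp \<phi> \<psi>)
  have "sat M e \<phi> \<longleftrightarrow> sat M e' \<phi>" by (rule Imp.IH(1)) (simp add: Imp.prems)
  moreover have "sat M e \<psi> \<longleftrightarrow> sat M e' \<psi>" by (rule Imp.IH(2)) (simp add: Imp.prems)
  ultimately show ?case by simp
next
  case (All v \<phi>)
  have "sat M (e(v := a)) \<phi> \<longleftrightarrow> sat M (e'(v := a)) \<phi>" for a
    by (rule All.IH) (simp add: All.prems)
  then show ?case by simp
qed auto

lemma sort_tm_vars: "wf_tm L t \<Longrightarrow> v \<in> tm_vars t \<Longrightarrow> snd v \<in> sorts L"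
  by (induction t) (auto simp: list_all_iff)

lemma sort_fv: "wf_fm L \<phi> \<Longrightarrow> v \<in> fv \<phi> \<Longrightarrow> snd v \<in> sorts L"
  by (induction \<phi>) (auto simp: list_all_iff dest: sort_tm_vars)

locale fo_struct =
  fixes L :: "('s, 'f, 'p) lang" and M :: "('s, 'f, 'p, 'a) struct"
  assumes lang: "is_lang L" and struct: "is_struct L M"
begin

text \<open>Indices are arbitrary, so that variables (with \<open>snd\<close>), elements (with
  \<open>sort_of M\<close>) and sums of elements (with \<open>sort2\<close>) can all serve. Values
  outside \<open>J\<close> are unrestricted.\<close>

definition assigns :: "('i \<Rightarrow> 's) \<Rightarrow> 'i set \<Rightarrow> ('i \<Rightarrow> 'a) set" where
  "assigns s J = {g. \<forall>i\<in>J. g i \<in> univ M \<and> sort_of M (g i) = s i}"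

lemma assigns_mono: "g \<in> assigns s J \<Longrightarrow> K \<subseteq> J \<Longrightarrow> g \<in> assigns s K"
  by (auto simp: assigns_def)

lemma sort_of_in_sorts: "a \<in> univ M \<Longrightarrow> sort_of M a \<in> sorts L"
  using struct unfolding is_struct_def by blast

lemma eval_closed:
  "wf_tm L t \<Longrightarrow> e \<in> assigns snd (tm_vars t) \<Longrightarrow>
    eval M e t \<in> univ M \<and> sort_of M (eval M e t) = tm_sort L t"
proof (induction t)
  case (Fun f ts)
  have IH: "eval M e t \<in> univ M \<and> sort_of M (eval M e t) = tm_sort L t" if "t \<in> set ts" for t
    using Fun.prems that by (intro Fun.IH) (auto simp: list_all_iff assigns_def)
  have "map (sort_of M) (map (eval M e) ts) = map (tm_sort L) ts" using IH by simp
  also have "\<dots> = fargs L f" using Fun.prems by simp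
  finally have "map (sort_of M) (map (eval M e) ts) = fargs L f" .
  moreover have "set (map (eval M e) ts) \<subseteq> univ M" using IH by auto
  moreover have "f \<in> fsyms L" using Fun.prems by simp
  ultimately show ?case using struct unfolding is_struct_def by (metis eval.simps(2) tm_sort.simps(2))
qed (auto simp: assigns_def)

text \<open>Substitution is expressed by \<open>\<exists>v. v = u \<and> \<phi>\<close>, so that bound variables never have to be
  renamed. For this the new variables must be disjoint from the old ones.\<close>

lemma rename_disjoint:
  assumes "finite V" "V \<subseteq> fv \<phi>" "wf_fm L \<phi>" "\<And>v. v \<in> V \<Longrightarrow> snd (r v) = snd v" "r ` V \<inter> V = {}"
  shows "\<exists>\<phi>'. wf_fm L \<phi>' \<and> fv \<phi>' \<subseteq> (fv \<phi> - V) \<union> r ` V \<and>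
    (\<forall>h. h \<in> assigns snd (r ` V) \<longrightarrow>
      (sat M h \<phi>' \<longleftrightarrow> sat M (\<lambda>v. if v \<in> V then h (r v) else h v) \<phi>))"
  using assms
proof (induction V)
  case empty
  then show ?case by (intro exI[of _ \<phi>]) auto
next
  case (insert v V)
  then obtain \<psi> where \<psi>: "wf_fm L \<psi>" "fv \<psi> \<subseteq> (fv \<phi> - V) \<union> r ` V"
    "\<And>h. h \<in> assigns snd (r ` V) \<Longrightarrow>
      (sat M h \<psi> \<longleftrightarrow> sat M (\<lambda>v. if v \<in> V then h (r v) else h v) \<phi>)" by auto
  let ?\<phi> = "Exi v (And (Eq (Var v) (Var (r v))) \<psi>)"
  have rv: "r v \<noteq> v" using insert.prems by auto
  have rV: "r u \<noteq> v" if "u \<in> V" for u using insert.prems that by auto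
  have sv: "snd v \<in> sorts L" using insert.prems sort_fv by blast
  have "sat M h ?\<phi> \<longleftrightarrow> sat M (\<lambda>u. if u \<in> insert v V then h (r u) else h u) \<phi>"
    if h: "h \<in> assigns snd (r ` insert v V)" for h
  proof -
    have "sat M h ?\<phi> \<longleftrightarrow> sat M (h(v := h (r v))) \<psi>"
      using h rv insert.prems(3) by (auto simp: assigns_def)
    also have "\<dots> \<longleftrightarrow> sat M (\<lambda>u. if u \<in> V then (h(v := h (r v))) (r u) else (h(v := h (r v))) u) \<phi>"
      using h rV by (intro \<psi>(3)) (auto simp: assigns_def)
    also have "(\<lambda>u. if u \<in> V then (h(v := h (r v))) (r u) else (h(v := h (r v))) u) =
        (\<lambda>u. if u \<in> insert v V then h (r u) else h u)"
      using rV by (auto simp: fun_eq_iff)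
    finally show ?thesis .
  qed
  moreover have "wf_fm L ?\<phi>" "fv ?\<phi> \<subseteq> (fv \<phi> - insert v V) \<union> r ` insert v V"
    using \<psi> sv insert.prems rv rV by auto
  ultimately show ?case by blast
qed

text \<open>Two disjoint renamings in a row: \<open>q\<close> moves the free variables to names
  beyond all those involved, and \<open>r \<circ> q'\<close> sends them on to their targets. Thus
  \<open>r\<close> may permute or identify the free variables.\<close>

lemma rename:
  assumes wf: "wf_fm L \<phi>" and r: "\<And>v. v \<in> fv \<phi> \<Longrightarrow> snd (r v) = snd v"
  shows "\<exists>\<phi>'. wf_fm L \<phi>' \<and> fv \<phi>' \<subseteq> r ` fv \<phi> \<and>
    (\<forall>h. h \<in> assigns snd (r ` fv \<phi>) \<longrightarrow> (sat M h \<phi>' \<longleftrightarrow> sat M (h \<circ> r) \<phi>))"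
proof -
  define N where "N = Suc (Max (fst ` (fv \<phi> \<union> r ` fv \<phi>)))"
  have N: "fst v < N" if "v \<in> fv \<phi> \<union> r ` fv \<phi>" for v
    unfolding N_def less_Suc_eq_le using that by (intro Max_ge) auto
  define q :: "'s vbl \<Rightarrow> 's vbl" where "q v = (fst v + N, snd v)" for v
  define q' :: "'s vbl \<Rightarrow> 's vbl" where "q' v = (fst v - N, snd v)" for v
  have q'q [simp]: "q' (q v) = v" for v by (simp add: q_def q'_def)
  have disj: "q v \<notin> fv \<phi>" "q v \<notin> r ` fv \<phi>" for v using N[of "q v"] by (auto simp: q_def)
  have sq: "snd (q v) = snd v" for v by (simp add: q_def)
  have "q ` fv \<phi> \<inter> fv \<phi> = {}" using disj(1) by blast
  then obtain \<psi> where \<psi>: "wf_fm L \<psi>" "fv \<psi> \<subseteq> q ` fv \<phi>"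
    "\<And>h. h \<in> assigns snd (q ` fv \<phi>) \<Longrightarrow>
      sat M h \<psi> \<longleftrightarrow> sat M (\<lambda>v. if v \<in> fv \<phi> then h (q v) else h v) \<phi>"
    using rename_disjoint[of "fv \<phi>" \<phi> q] wf sq by auto
  have "snd ((r \<circ> q') v) = snd v" if "v \<in> fv \<psi>" for v using that \<psi>(2) r sq by auto
  moreover have "(r \<circ> q') ` fv \<psi> \<inter> fv \<psi> = {}"
  proof -
    have "r u \<notin> fv \<psi>" if "u \<in> fv \<phi>" for u using \<psi>(2) disj(2) that by (metis imageE imageI subsetD)
    then show ?thesis using \<psi>(2) by auto
  qed
  ultimately obtain \<chi> where \<chi>: "wf_fm L \<chi>" "fv \<chi> \<subseteq> (r \<circ> q') ` fv \<psi>"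
    "\<And>h. h \<in> assigns snd ((r \<circ> q') ` fv \<psi>) \<Longrightarrow>
      sat M h \<chi> \<longleftrightarrow> sat M (\<lambda>v. if v \<in> fv \<psi> then h ((r \<circ> q') v) else h v) \<psi>"
    using rename_disjoint[of "fv \<psi>" \<psi> "r \<circ> q'"] \<psi>(1) by auto
  have sub: "(r \<circ> q') ` fv \<psi> \<subseteq> r ` fv \<phi>" using \<psi>(2) by force
  have "sat M h \<chi> \<longleftrightarrow> sat M (h \<circ> r) \<phi>" if h: "h \<in> assigns snd (r ` fv \<phi>)" for h
  proof -
    have "sat M h \<chi> \<longleftrightarrow> sat M (\<lambda>v. if v \<in> fv \<psi> then h ((r \<circ> q') v) else h v) \<psi>"
      using \<chi>(3) assigns_mono[OF h sub] .
    also have "\<dots> \<longleftrightarrow> sat M (h \<circ> r \<circ> q') \<psi>" by (rule sat_cong) auto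
    also have "\<dots> \<longleftrightarrow> sat M (\<lambda>v. if v \<in> fv \<phi> then (h \<circ> r \<circ> q') (q v) else (h \<circ> r \<circ> q') v) \<phi>"
      using h r by (intro \<psi>(3)) (auto simp: assigns_def q_def q'_def)
    also have "\<dots> \<longleftrightarrow> sat M (h \<circ> r) \<phi>" by (rule sat_cong) auto
    finally show ?thesis .
  qed
  then show ?thesis using \<chi> sub by blast
qed

section \<open>Definable predicates\<close>

text \<open>Definability has to hold for every choice \<open>w\<close> of variables for the indices, so that formulas for
  several predicates can be combined without renaming.\<close>

definition definable :: "('i \<Rightarrow> 's) \<Rightarrow> 'i set \<Rightarrow> (('i \<Rightarrow> 'a) \<Rightarrow> bool) \<Rightarrow> bool" where
  "definable s J P \<longleftrightarrow>
    (\<forall>w. inj_on w J \<and> (\<forall>j\<in>J. snd (w j) = s j) \<longrightarrow>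
      (\<exists>\<phi>. wf_fm L \<phi> \<and> fv \<phi> \<subseteq> w ` J \<and>
        (\<forall>g\<in>assigns s J. \<forall>h. (\<forall>j\<in>J. h (w j) = g j) \<longrightarrow> (P g \<longleftrightarrow> sat M h \<phi>))))"

lemma definableE:
  assumes "definable s J P" "inj_on w J" "\<And>j. j \<in> J \<Longrightarrow> snd (w j) = s j"
  obtains \<phi> where "wf_fm L \<phi>" "fv \<phi> \<subseteq> w ` J"
    "\<And>g h. g \<in> assigns s J \<Longrightarrow> (\<And>j. j \<in> J \<Longrightarrow> h (w j) = g j) \<Longrightarrow> P g \<longleftrightarrow> sat M h \<phi>"
  using assms unfolding definable_def by (metis (full_types))

lemma ex_vars:
  assumes "finite (J :: 'i set)"
  shows "\<exists>w :: 'i \<Rightarrow> 's vbl. inj_on w J \<and> (\<forall>j. snd (w j) = s j)"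
proof -
  obtain k :: "'i \<Rightarrow> nat" where "inj_on k J" using assms finite_imp_inj_to_nat_seg by blast
  then show ?thesis by (intro exI[of _ "\<lambda>j. (k j, s j)"]) (auto simp: inj_on_def)
qed

text \<open>One formula evaluates \<open>g\<close> and \<open>g'\<close> under the same variable
  assignment. Finiteness of \<open>J\<close> supplies distinct variables for its indices; if there
  were none, definability would be vacuous.\<close>

lemma definable_cong:
  assumes "definable s J P" "finite J" "g \<in> assigns s J" "\<And>j. j \<in> J \<Longrightarrow> g j = g' j"
  shows "P g \<longleftrightarrow> P g'"
proof -
  obtain w :: "_ \<Rightarrow> 's vbl" where w: "inj_on w J" "\<And>j. snd (w j) = s j"
    using ex_vars[OF assms(2), of s] by metis
  obtain \<phi> where \<phi>: "\<And>g h. g \<in> assigns s J \<Longrightarrow> (\<And>j. j \<in> J \<Longrightarrow> h (w j) = g j) \<Longrightarrow> P g \<longleftrightarrow> sat M h \<phi>"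
    using definableE[OF assms(1) w] by metis
  have "g' \<in> assigns s J" using assms by (auto simp: assigns_def)
  with \<phi>[of g "g \<circ> inv_into J w"] \<phi>[of g' "g \<circ> inv_into J w"] show ?thesis
    using assms w by simp
qed

text \<open>The source of definable predicates, and the place where renaming enters:
  \<open>e\<close> may send several variables to one index, and the formula for a choice
  \<open>w\<close> is \<open>\<phi>\<close> renamed along \<open>w \<circ> e\<close>.\<close>

lemma definable_sat:
  fixes J :: "'i set"
  assumes "wf_fm L \<phi>" "\<And>v. v \<in> fv \<phi> \<Longrightarrow> e v \<in> J \<and> s (e v) = snd v"
  shows "definable s J (\<lambda>g. sat M (g \<circ> e) \<phi>)"
  unfolding definable_def
proof (intro allI impI, elim conjE)
  fix w :: "'i \<Rightarrow> 's vbl" assume w: "inj_on w J" "\<forall>j\<in>J. snd (w j) = s j"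
  obtain \<psi> where \<psi>: "wf_fm L \<psi>" "fv \<psi> \<subseteq> (w \<circ> e) ` fv \<phi>"
    "\<And>h. h \<in> assigns snd ((w \<circ> e) ` fv \<phi>) \<Longrightarrow> sat M h \<psi> \<longleftrightarrow> sat M (h \<circ> (w \<circ> e)) \<phi>"
    using rename[OF assms(1), of "w \<circ> e"] w assms(2) by auto
  have "sat M (g \<circ> e) \<phi> \<longleftrightarrow> sat M h \<psi>"
    if "g \<in> assigns s J" "\<forall>j\<in>J. h (w j) = g j" for g h
  proof -
    have "sat M h \<psi> \<longleftrightarrow> sat M (h \<circ> (w \<circ> e)) \<phi>"
      using that assms(2) w by (intro \<psi>(3)) (auto simp: assigns_def)
    also have "\<dots> \<longleftrightarrow> sat M (g \<circ> e) \<phi>" using that assms(2) by (intro sat_cong) auto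
    finally show ?thesis by simp
  qed
  then show "\<exists>\<phi>'. wf_fm L \<phi>' \<and> fv \<phi>' \<subseteq> w ` J \<and>
      (\<forall>g\<in>assigns s J. \<forall>h. (\<forall>j\<in>J. h (w j) = g j) \<longrightarrow> (sat M (g \<circ> e) \<phi> \<longleftrightarrow> sat M h \<phi>'))"
    using \<psi> assms(2) by (intro exI[of _ \<psi>]) auto
qed

lemma definable_mono:
  fixes J :: "'i set"
  assumes "definable s J P" "J \<subseteq> K"
  shows "definable s K P"
  unfolding definable_def
proof (intro allI impI, elim conjE)
  fix w :: "'i \<Rightarrow> 's vbl" assume w: "inj_on w K" "\<forall>j\<in>K. snd (w j) = s j"
  have "inj_on w J" using w assms(2) inj_on_subset by blast
  with assms(1) obtain \<phi> where \<phi>: "wf_fm L \<phi>" "fv \<phi> \<subseteq> w ` J"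
    "\<And>g h. g \<in> assigns s J \<Longrightarrow> (\<And>j. j \<in> J \<Longrightarrow> h (w j) = g j) \<Longrightarrow> P g \<longleftrightarrow> sat M h \<phi>"
    by (rule definableE) (use w assms in auto)
  show "\<exists>\<phi>. wf_fm L \<phi> \<and> fv \<phi> \<subseteq> w ` K \<and>
      (\<forall>g\<in>assigns s K. \<forall>h. (\<forall>j\<in>K. h (w j) = g j) \<longrightarrow> (P g \<longleftrightarrow> sat M h \<phi>))"
  proof (intro exI conjI ballI allI impI)
    show "P g \<longleftrightarrow> sat M h \<phi>" if "g \<in> assigns s K" "\<forall>j\<in>K. h (w j) = g j" for g h
      using \<phi>(3)[of g h] that assms(2) assigns_mono by blast
  qed (use \<phi>(1,2) assms(2) in blast)+
qed

lemma definable_imp: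
  fixes J :: "'i set"
  assumes "definable s J P" "definable s J Q"
  shows "definable s J (\<lambda>g. P g \<longrightarrow> Q g)"
  unfolding definable_def
proof (intro allI impI, elim conjE)
  fix w :: "'i \<Rightarrow> 's vbl" assume w: "inj_on w J" "\<forall>j\<in>J. snd (w j) = s j"
  obtain \<phi> where \<phi>: "wf_fm L \<phi>" "fv \<phi> \<subseteq> w ` J"
    "\<And>g h. g \<in> assigns s J \<Longrightarrow> (\<And>j. j \<in> J \<Longrightarrow> h (w j) = g j) \<Longrightarrow> P g \<longleftrightarrow> sat M h \<phi>"
    using definableE[OF assms(1)] w by metis
  obtain \<psi> where \<psi>: "wf_fm L \<psi>" "fv \<psi> \<subseteq> w ` J"
    "\<And>g h. g \<in> assigns s J \<Longrightarrow> (\<And>j. j \<in> J \<Longrightarrow> h (w j) = g j) \<Longrightarrow> Q g \<longleftrightarrow> sat M h \<psi>"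
    using definableE[OF assms(2)] w by metis
  show "\<exists>\<phi>. wf_fm L \<phi> \<and> fv \<phi> \<subseteq> w ` J \<and>
      (\<forall>g\<in>assigns s J. \<forall>h. (\<forall>j\<in>J. h (w j) = g j) \<longrightarrow> ((P g \<longrightarrow> Q g) \<longleftrightarrow> sat M h \<phi>))"
  proof (intro exI conjI ballI allI impI)
    show "(P g \<longrightarrow> Q g) \<longleftrightarrow> sat M h (Imp \<phi> \<psi>)" if "g \<in> assigns s J" "\<forall>j\<in>J. h (w j) = g j" for g h
      using \<phi>(3)[of g h] \<psi>(3)[of g h] that by simp
  qed (use \<phi> \<psi> in auto)
qed

lemma definable_False: "definable s J (\<lambda>_. False)"
  unfolding definable_def by (auto intro!: exI[of _ Falsum])

lemma definable_not: "definable s J P \<Longrightarrow> definable s J (\<lambda>g. \<not> P g)"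
  using definable_imp[OF _ definable_False] by auto

lemma definable_conj:
  "definable s J P \<Longrightarrow> definable s J Q \<Longrightarrow> definable s J (\<lambda>g. P g \<and> Q g)"
  using definable_not[OF definable_imp[OF _ definable_not], of s J P Q] by simp

lemma definable_Ball:
  "finite \<Gamma> \<Longrightarrow> (\<And>P. P \<in> \<Gamma> \<Longrightarrow> definable s J P) \<Longrightarrow> definable s J (\<lambda>g. \<forall>P\<in>\<Gamma>. P g)"
proof (induction \<Gamma> rule: finite_induct)
  case empty
  then show ?case using definable_not[OF definable_False] by simp
next
  case (insert P \<Gamma>)
  then show ?case using definable_conj[of s J P] by simp
qed

text \<open>The given \<open>w\<close> is arbitrary at \<open>i\<close> and may clash there with the
  variables of \<open>J\<close>. Giving \<open>i\<close> a new name makes the formula for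
  \<open>insert i J\<close> available for quantification.\<close>

lemma definable_all:
  fixes J :: "'i set"
  assumes P: "definable s (insert i J) P" and fin: "finite J" "i \<notin> J" "s i \<in> sorts L"
  shows "definable s J (\<lambda>g. \<forall>a\<in>univ M. sort_of M a = s i \<longrightarrow> P (g(i := a)))"
  unfolding definable_def
proof (intro allI impI, elim conjE)
  fix w :: "'i \<Rightarrow> 's vbl" assume w: "inj_on w J" "\<forall>j\<in>J. snd (w j) = s j"
  obtain n where n: "n \<notin> fst ` w ` J" using ex_new_if_finite[of "fst ` w ` J"] fin by auto
  define w' where "w' = w(i := (n, s i))"
  have w'J: "w' j = w j" if "j \<in> J" for j using that fin by (auto simp: w'_def)
  have new: "w' i \<notin> w ` J" using n by (metis fst_conv fun_upd_same imageI w'_def)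
  have "inj_on w' J" using w(1) w'J by (simp add: inj_on_def)
  moreover have "w' i \<notin> w' ` J" using new w'J by auto
  ultimately have inj: "inj_on w' (insert i J)" using fin(2) by simp
  have sort: "snd (w' j) = s j" if "j \<in> insert i J" for j using w(2) that by (auto simp: w'_def)
  obtain \<phi> where \<phi>: "wf_fm L \<phi>" "fv \<phi> \<subseteq> w' ` insert i J"
    "\<And>g h. g \<in> assigns s (insert i J) \<Longrightarrow> (\<And>j. j \<in> insert i J \<Longrightarrow> h (w' j) = g j) \<Longrightarrow>
      P g \<longleftrightarrow> sat M h \<phi>"
    using definableE[OF P inj sort] by metis
  have "P (g(i := a)) \<longleftrightarrow> sat M (h(w' i := a)) \<phi>"
    if "g \<in> assigns s J" "\<forall>j\<in>J. h (w j) = g j" "a \<in> univ M" "sort_of M a = s i" for g h a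
  proof (rule \<phi>(3))
    show "g(i := a) \<in> assigns s (insert i J)" using that by (auto simp: assigns_def)
    show "(h(w' i := a)) (w' j) = (g(i := a)) j" if "j \<in> insert i J" for j
    proof (cases "j = i")
      case False
      then have "j \<in> J" using that by simp
      then have "w' j \<noteq> w' i" using new w'J by (metis imageI)
      then show ?thesis using False \<open>j \<in> J\<close> w'J \<open>\<forall>j\<in>J. h (w j) = g j\<close> by simp
    qed simp
  qed
  then have "(\<forall>a\<in>univ M. sort_of M a = s i \<longrightarrow> P (g(i := a))) \<longleftrightarrow> sat M h (All (w' i) \<phi>)"
    if "g \<in> assigns s J" "\<forall>j\<in>J. h (w j) = g j" for g h
    using that by (simp add: w'_def)
  moreover have "fv (All (w' i) \<phi>) \<subseteq> w ` J" using \<phi>(2) w'J by auto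
  moreover have "wf_fm L (All (w' i) \<phi>)" using \<phi>(1) fin(3) by (simp add: w'_def)
  ultimately show "\<exists>\<phi>. wf_fm L \<phi> \<and> fv \<phi> \<subseteq> w ` J \<and> (\<forall>g\<in>assigns s J. \<forall>h. (\<forall>j\<in>J. h (w j) = g j) \<longrightarrow>
      ((\<forall>a\<in>univ M. sort_of M a = s i \<longrightarrow> P (g(i := a))) \<longleftrightarrow> sat M h \<phi>))"
    by blast
qed

text \<open>One index at a time is quantified, with \<open>J\<close> growing as \<open>K\<close>
  shrinks. Speaking of an assignment \<open>g'\<close> on all of \<open>J \<union> K\<close> instead
  of iterated updates frees the statement from an order on \<open>K\<close>.\<close>

lemma definable_ex_set:
  assumes "finite K" "finite J" "J \<inter> K = {}" "s ` K \<subseteq> sorts L" "definable s (J \<union> K) P"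
  shows "definable s J (\<lambda>g. \<exists>g'\<in>assigns s (J \<union> K). (\<forall>j\<in>J. g' j = g j) \<and> P g')"
  using assms
proof (induction K arbitrary: J rule: finite_induct)
  case empty
  let ?Q = "\<lambda>g. \<exists>g'\<in>assigns s (J \<union> {}). (\<forall>j\<in>J. g' j = g j) \<and> P g'"
  have "?Q g \<longleftrightarrow> P g" if "g \<in> assigns s J" for g
  proof
    show "P g" if "?Q g"
    proof -
      from that obtain g' where "g' \<in> assigns s J" "\<forall>j\<in>J. g' j = g j" "P g'" by auto
      then show ?thesis using definable_cong[of s J P g' g] empty.prems by simp
    qed
    show "?Q g" if "P g" using that \<open>g \<in> assigns s J\<close> by auto
  qed
  then show ?case using empty.prems unfolding definable_def by simp
next
  case (insert i K)
  let ?Q = "\<lambda>g. \<exists>g'\<in>assigns s (insert i J \<union> K). (\<forall>j\<in>insert i J. g' j = g j) \<and> P g'"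
  have "definable s (insert i J) ?Q" using insert by (intro insert.IH) auto
  then have "definable s J (\<lambda>g. \<not> (\<forall>a\<in>univ M. sort_of M a = s i \<longrightarrow> \<not> ?Q (g(i := a))))"
    using insert.prems by (intro definable_not definable_all) auto
  moreover have "(\<not> (\<forall>a\<in>univ M. sort_of M a = s i \<longrightarrow> \<not> ?Q (g(i := a)))) \<longleftrightarrow>
      (\<exists>g'\<in>assigns s (J \<union> insert i K). (\<forall>j\<in>J. g' j = g j) \<and> P g')" for g
  proof -
    have "(\<exists>a\<in>univ M. sort_of M a = s i \<and> ?Q (g(i := a))) \<longleftrightarrow>
      (\<exists>g'\<in>assigns s (insert i J \<union> K). (\<forall>j\<in>J. g' j = g j) \<and> P g')" (is "?l \<longleftrightarrow> ?r")
    proof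
      assume ?l
      then obtain a g' where g': "g' \<in> assigns s (insert i J \<union> K)"
        "\<forall>j\<in>insert i J. g' j = (g(i := a)) j" "P g'" by blast
      have "g' j = g j" if "j \<in> J" for j
      proof -
        have "j \<noteq> i" using that insert.prems(2) by auto
        then show ?thesis using g'(2) that by simp
      qed
      then show ?r using g' by blast
    next
      assume ?r
      then obtain g' where g': "g' \<in> assigns s (insert i J \<union> K)" "\<forall>j\<in>J. g' j = g j" "P g'" by blast
      then have "?Q (g(i := g' i))" by (intro bexI[of _ g']) auto
      moreover have "g' i \<in> univ M" "sort_of M (g' i) = s i" using g' by (auto simp: assigns_def)
      ultimately show ?l by blast
    qed
    then show ?thesis by simp
  qed
  ultimately show ?case by (simp only:)
qed

end

section \<open>Compactness in saturated structures\<close>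

context fo_struct
begin

text \<open>The cardinality part of \<open>small\<close>, separated from \<open>univ M\<close> so
  that it applies to index sets and to sets of pairs.\<close>

definition few :: "'x set \<Rightarrow> bool" where
  "few X \<longleftrightarrow> finite X \<or> |X| <o |univ M|"

lemma small_iff: "small M A \<longleftrightarrow> A \<subseteq> univ M \<and> few A"
  by (auto simp: small_def few_def)

lemma few_subset: "few B \<Longrightarrow> A \<subseteq> B \<Longrightarrow> few A"
  unfolding few_def by (meson card_of_mono1 finite_subset ordLeq_ordLess_trans)

lemma few_image: "few A \<Longrightarrow> few (f ` A)"
  unfolding few_def by (meson card_of_image finite_imageI ordLeq_ordLess_trans)

lemma few_Un:
  assumes "few A" "few B"
  shows "few (A \<union> B)"
proof (cases "finite (univ M)")
  case True
  then have "finite A" "finite B"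
    using assms card_of_ordLeq_finite ordLess_imp_ordLeq unfolding few_def by blast+
  then show ?thesis by (simp add: few_def)
next
  case False
  then have "|A| <o |univ M|" "|B| <o |univ M|"
    using assms finite_ordLess_infinite[OF card_of_Well_order card_of_Well_order] False
    unfolding few_def by (metis Field_card_of)+
  then show ?thesis using card_of_Un_ordLess_infinite[OF False] unfolding few_def by blast
qed

text \<open>\<open>G\<close> is the graph of a partial assignment, kept as a set of pairs so that
  Zorn's lemma applies to inclusion. The case \<open>\<Gamma>0 = {}\<close> already forces it to be
  single-valued and to respect sorts.\<close>

definition fin_sat :: "('i \<Rightarrow> 's) \<Rightarrow> 'i set \<Rightarrow> (('i \<Rightarrow> 'a) \<Rightarrow> bool) set \<Rightarrow> ('i \<times> 'a) set \<Rightarrow> bool" where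
  "fin_sat s I \<Gamma> G \<longleftrightarrow> Domain G \<subseteq> I \<and>
    (\<forall>\<Gamma>0. finite \<Gamma>0 \<and> \<Gamma>0 \<subseteq> \<Gamma> \<longrightarrow>
      (\<exists>g\<in>assigns s I. (\<forall>i a. (i, a) \<in> G \<longrightarrow> g i = a) \<and> (\<forall>P\<in>\<Gamma>0. P g)))"

lemma fin_satD:
  assumes "fin_sat s I \<Gamma> G" "finite \<Gamma>0" "\<Gamma>0 \<subseteq> \<Gamma>"
  obtains g where "g \<in> assigns s I" "\<forall>i a. (i, a) \<in> G \<longrightarrow> g i = a" "\<forall>P\<in>\<Gamma>0. P g"
  using assms unfolding fin_sat_def by blast

lemma fin_sat_assign:
  assumes "fin_sat s I \<Gamma> G"
  shows "\<exists>g\<in>assigns s I. \<forall>i a. (i, a) \<in> G \<longrightarrow> g i = a"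
  using assms unfolding fin_sat_def by (metis empty_subsetI finite.emptyI)

lemma common_support:
  assumes "\<And>P. P \<in> \<Gamma> \<Longrightarrow> \<exists>J. finite J \<and> J \<subseteq> I \<and> definable s J P" "finite \<Gamma>"
  shows "\<exists>J. finite J \<and> J \<subseteq> I \<and> (\<forall>P\<in>\<Gamma>. definable s J P)"
proof -
  from assms(1) obtain J where J: "\<And>P. P \<in> \<Gamma> \<Longrightarrow> finite (J P) \<and> J P \<subseteq> I \<and> definable s (J P) P"
    by metis
  have "definable s (\<Union> (J ` \<Gamma>)) P" if "P \<in> \<Gamma>" for P
    using definable_mono[of s "J P" P] J that by blast
  then show ?thesis using J assms(2) by (intro exI[of _ "\<Union> (J ` \<Gamma>)"]) auto
qed

text \<open>Solvability of finitely many conditions, as a property of the value at the index \<open>i\<close>: all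
  other indices are either evaluated by \<open>g\<close> or quantified existentially.\<close>

lemma solvable_formula:
  fixes I :: "'i set"
  assumes sorts: "s ` I \<subseteq> sorts L"
    and J: "finite J" "J \<subseteq> I" "definable s J P"
    and g: "g \<in> assigns s I" and D: "D \<subseteq> I" and i: "i \<in> I" "i \<notin> D"
  shows "\<exists>\<phi> e. (\<phi>, e) \<in> fm_over L M (0, s i) (g ` D) \<and>
    (\<forall>a. a \<in> univ M \<and> sort_of M a = s i \<longrightarrow>
      (sat M (e((0, s i) := a)) \<phi> \<longleftrightarrow>
        (\<exists>g'\<in>assigns s I. (\<forall>j\<in>D. g' j = g j) \<and> g' i = a \<and> P g')))"
proof -
  let ?x = "(0, s i) :: 's vbl"
  \<comment> \<open>\<open>J0\<close> consists of the unknown index and the finitely many evaluated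
    indices in the support of \<open>P\<close>; the rest of the support, \<open>K\<close>, is to be
    quantified.\<close>
  define J0 where "J0 = insert i (J \<inter> D)"
  define K where "K = J - J0"
  have fin: "finite J0" "finite K" and sub: "J0 \<union> K \<subseteq> I" "J \<subseteq> J0 \<union> K" and disj: "J0 \<inter> K = {}"
    using J i by (auto simp: J0_def K_def)
  define R where "R h \<longleftrightarrow> (\<exists>g'\<in>assigns s (J0 \<union> K). (\<forall>j\<in>J0. g' j = h j) \<and> P g')" for h
  have PJ: "definable s (J0 \<union> K) P" using definable_mono[OF J(3) sub(2)] .
  have sK: "s ` K \<subseteq> sorts L" using sorts sub by blast
  have R: "definable s J0 R"
    using definable_ex_set[OF fin(2,1) disj sK PJ] unfolding R_def[abs_def] .
  obtain w0 :: "'i \<Rightarrow> 's vbl" where w0: "inj_on w0 J0" "\<And>j. snd (w0 j) = s j"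
    using ex_vars[OF fin(1), of s] by metis
  \<comment> \<open>The name 0 is reserved for the unknown at \<open>i\<close> and the names of all
    other indices are shifted past it, so \<open>?x\<close> cannot clash with a variable standing
    for a parameter.\<close>
  define w where "w j = (if j = i then 0 else Suc (fst (w0 j)), s j)" for j
  have w: "inj_on w J0"
  proof (rule inj_onI)
    fix j k assume jk: "j \<in> J0" "k \<in> J0" "w j = w k"
    then have "j = i \<and> k = i \<or> w0 j = w0 k"
      using w0(2) by (auto simp: w_def prod_eq_iff split: if_splits)
    then show "j = k" using jk w0(1) by (auto dest: inj_onD)
  qed
  have wi: "w i = ?x" and ws: "snd (w j) = s j" for j by (auto simp: w_def)
  have wx: "w j \<noteq> ?x" if "j \<noteq> i" for j using that by (simp add: w_def)
  obtain \<phi> where \<phi>: "wf_fm L \<phi>" "fv \<phi> \<subseteq> w ` J0"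
    "\<And>g h. g \<in> assigns s J0 \<Longrightarrow> (\<And>j. j \<in> J0 \<Longrightarrow> h (w j) = g j) \<Longrightarrow> R g \<longleftrightarrow> sat M h \<phi>"
    using definableE[OF R w ws] by metis
  define e where "e v = g (inv_into J0 w v)" for v
  have ew: "e (w j) = g j" if "j \<in> J0" for j using that w by (simp add: e_def)
  have "e v \<in> g ` D \<and> sort_of M (e v) = snd v" if v: "v \<in> fv \<phi> - {?x}" for v
  proof -
    obtain j where j: "j \<in> J0" "v = w j" using v \<phi>(2) by blast
    then have "j \<in> D" using v wi by (auto simp: J0_def)
    then show ?thesis using j ew ws g D by (auto simp: assigns_def)
  qed
  then have over: "(\<phi>, e) \<in> fm_over L M ?x (g ` D)" using \<phi>(1) by (auto simp: fm_over_def)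
  have "sat M (e(?x := a)) \<phi> \<longleftrightarrow>
      (\<exists>g'\<in>assigns s I. (\<forall>j\<in>D. g' j = g j) \<and> g' i = a \<and> P g')"
    if a: "a \<in> univ M" "sort_of M a = s i" for a
  proof -
    have "R (g(i := a)) \<longleftrightarrow> sat M (e(?x := a)) \<phi>"
    proof (rule \<phi>(3))
      show "g(i := a) \<in> assigns s J0" using g a sub by (auto simp: assigns_def)
      show "(e(?x := a)) (w j) = (g(i := a)) j" if "j \<in> J0" for j
        using that wi wx ew by (cases "j = i") auto
    qed
    moreover have "R (g(i := a)) \<longleftrightarrow>
        (\<exists>g'\<in>assigns s I. (\<forall>j\<in>D. g' j = g j) \<and> g' i = a \<and> P g')" (is "_ \<longleftrightarrow> ?Q")
    proof
      assume "R (g(i := a))"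
      then obtain g' where g': "g' \<in> assigns s (J0 \<union> K)" "\<And>j. j \<in> J0 \<Longrightarrow> g' j = (g(i := a)) j" "P g'"
        unfolding R_def by blast
      \<comment> \<open>\<open>g'\<close> is controlled only on \<open>J0 \<union> K\<close>.
        Continuing it by \<open>g\<close> gives an assignment of all of \<open>I\<close> without
        changing \<open>P\<close> or the values on \<open>D\<close>.\<close>
      define k where "k j = (if j \<in> J0 \<union> K then g' j else g j)" for j
      have "P k" using definable_cong[OF PJ _ g'(1), of k] fin g'(3) by (simp add: k_def)
      moreover have "k \<in> assigns s I" using g g'(1) by (auto simp: assigns_def k_def)
      moreover have "k i = a" using g'(2) by (auto simp: k_def J0_def)
      moreover have "k j = g j" if "j \<in> D" for j
      proof (cases "j \<in> J0 \<union> K")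
        case True
        then have "j \<in> J0" using that by (auto simp: J0_def K_def)
        moreover have "j \<noteq> i" using that i by blast
        ultimately show ?thesis using g'(2) by (simp add: k_def)
      qed (simp add: k_def)
      ultimately show ?Q by blast
    next
      assume ?Q
      then obtain g' where g': "g' \<in> assigns s I" "\<And>j. j \<in> D \<Longrightarrow> g' j = g j" "g' i = a" "P g'"
        by blast
      then show "R (g(i := a))" using assigns_mono[OF g'(1) sub(1)] unfolding R_def
        by (intro bexI[of _ g']) (auto simp: J0_def)
    qed
    ultimately show ?thesis by simp
  qed
  with over show ?thesis by blast
qed

end

section \<open>Realizing types in few variables\<close>

locale saturated_struct = fo_struct L M
  for L :: "('s, 'f, 'p) lang" and M :: "('s, 'f, 'p, 'a) struct" +
  assumes sat: "saturated L M"
begin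

text \<open>For each finite \<open>\<Gamma>0\<close>, the values at \<open>i\<close> that still
  allow a solution of \<open>\<Gamma>0\<close> extending \<open>G\<close> form a set defined by a
  formula over the values of \<open>G\<close>. Finitely many such formulas are realized together by
  the value at \<open>i\<close> of one solution of the union of their \<open>\<Gamma>0\<close>, so
  saturation gives a value that is good for all \<open>\<Gamma>0\<close>.\<close>

lemma fin_sat_extend:
  fixes I :: "'i set"
  assumes few: "few I" and sorts: "s ` I \<subseteq> sorts L"
    and supp: "\<And>P. P \<in> \<Gamma> \<Longrightarrow> \<exists>J. finite J \<and> J \<subseteq> I \<and> definable s J P"
    and G: "fin_sat s I \<Gamma> G" and i: "i \<in> I"
  shows "\<exists>a. fin_sat s I \<Gamma> (insert (i, a) G)"
proof (cases "i \<in> Domain G")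
  case True
  then show ?thesis using G by (metis Domain.cases insert_absorb)
next
  case False
  let ?x = "(0, s i) :: 's vbl"
  have D: "Domain G \<subseteq> I" using G by (simp add: fin_sat_def)
  obtain g where g: "g \<in> assigns s I" "\<And>i a. (i, a) \<in> G \<Longrightarrow> g i = a"
    using fin_sat_assign[OF G] by blast
  define Q where "Q \<Gamma>0 a \<longleftrightarrow>
    (\<exists>g'\<in>assigns s I. (\<forall>j\<in>Domain G. g' j = g j) \<and> g' i = a \<and> (\<forall>P\<in>\<Gamma>0. P g'))" for \<Gamma>0 a
  \<comment> \<open>All formulas equivalent to some solvability condition are taken, so none has to
    be chosen for each \<open>\<Gamma>0\<close>.\<close>
  define p where "p = {(\<phi>, e). (\<phi>, e) \<in> fm_over L M ?x (g ` Domain G) \<and>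
    (\<exists>\<Gamma>0. finite \<Gamma>0 \<and> \<Gamma>0 \<subseteq> \<Gamma> \<and>
      (\<forall>a. a \<in> univ M \<and> sort_of M a = s i \<longrightarrow> (sat M (e(?x := a)) \<phi> \<longleftrightarrow> Q \<Gamma>0 a)))}"
  have "\<exists>a. realizes M ?x a q" if q: "finite q" "q \<subseteq> p" for q
  proof -
    have "\<forall>c\<in>q. \<exists>\<Gamma>0. finite \<Gamma>0 \<and> \<Gamma>0 \<subseteq> \<Gamma> \<and> (\<forall>a. a \<in> univ M \<and> sort_of M a = s i \<longrightarrow>
        (sat M ((snd c)(?x := a)) (fst c) \<longleftrightarrow> Q \<Gamma>0 a))"
      using q(2) by (auto simp: p_def)
    from bchoice[OF this] obtain C where C: "\<forall>c\<in>q. finite (C c) \<and> C c \<subseteq> \<Gamma> \<and>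
        (\<forall>a. a \<in> univ M \<and> sort_of M a = s i \<longrightarrow> (sat M ((snd c)(?x := a)) (fst c) \<longleftrightarrow> Q (C c) a))"
      ..
    have "finite (\<Union> (C ` q))" "\<Union> (C ` q) \<subseteq> \<Gamma>" using C q(1) by auto
    then obtain k where k: "k \<in> assigns s I" "\<forall>j a. (j, a) \<in> G \<longrightarrow> k j = a" "\<forall>P\<in>\<Union> (C ` q). P k"
      by (rule fin_satD[OF G])
    have "Q (C c) (k i)" if "c \<in> q" for c
      unfolding Q_def using k g(2) that by (intro bexI[of _ k]) auto
    moreover have "k i \<in> univ M" "sort_of M (k i) = s i" using k(1) i by (auto simp: assigns_def)
    ultimately have "realizes M ?x (k i) q" using C by (auto simp: realizes_def)
    then show ?thesis ..
  qed
  moreover have "small M (g ` Domain G)"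
    using few_image few_subset[OF few D] g(1) D by (auto simp: small_iff assigns_def)
  moreover have "p \<subseteq> fm_over L M ?x (g ` Domain G)" by (auto simp: p_def)
  moreover have "snd ?x \<in> sorts L" using sorts i by auto
  ultimately obtain a where a: "realizes M ?x a p" using sat unfolding saturated_def by metis
  have Q: "Q \<Gamma>0 a" if \<Gamma>0: "finite \<Gamma>0" "\<Gamma>0 \<subseteq> \<Gamma>" for \<Gamma>0
  proof -
    obtain J where J: "finite J" "J \<subseteq> I" "\<forall>P\<in>\<Gamma>0. definable s J P"
      using common_support[of \<Gamma>0 I s] supp \<Gamma>0 by blast
    have "definable s J (\<lambda>g. \<forall>P\<in>\<Gamma>0. P g)" using definable_Ball \<Gamma>0(1) J(3) by blast
    from solvable_formula[OF sorts J(1,2) this g(1) D i False]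
    obtain \<phi> e where \<phi>: "(\<phi>, e) \<in> fm_over L M ?x (g ` Domain G)"
      "\<forall>a. a \<in> univ M \<and> sort_of M a = s i \<longrightarrow> (sat M (e(?x := a)) \<phi> \<longleftrightarrow> Q \<Gamma>0 a)"
      unfolding Q_def by blast
    then have "(\<phi>, e) \<in> p" using \<Gamma>0 by (auto simp: p_def)
    then show ?thesis using a \<phi>(2) by (auto simp: realizes_def)
  qed
  have "fin_sat s I \<Gamma> (insert (i, a) G)"
    unfolding fin_sat_def
  proof (intro conjI allI impI)
    show "Domain (insert (i, a) G) \<subseteq> I" using D i by auto
    fix \<Gamma>0 assume "finite \<Gamma>0 \<and> \<Gamma>0 \<subseteq> \<Gamma>"
    then obtain g' where "g' \<in> assigns s I" "\<forall>j\<in>Domain G. g' j = g j" "g' i = a" "\<forall>P\<in>\<Gamma>0. P g'"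
      using Q unfolding Q_def by blast
    then show "\<exists>g\<in>assigns s I. (\<forall>j b. (j, b) \<in> insert (i, a) G \<longrightarrow> g j = b) \<and> (\<forall>P\<in>\<Gamma>0. P g)"
      using g(2) by (intro bexI[of _ g']) auto
  qed
  then show ?thesis ..
qed

text \<open>A solution provided by one member of the chain need not extend the whole union. But
  \<open>\<Gamma>0\<close> depends on finitely many indices \<open>J\<close>, and the part of the
  union over \<open>J\<close> is finite, hence contained in one member. Its solution can be
  overwritten by the union everywhere else without affecting \<open>\<Gamma>0\<close>.\<close>

lemma fin_sat_Union_chain:
  fixes I :: "'i set"
  assumes supp: "\<And>P. P \<in> \<Gamma> \<Longrightarrow> \<exists>J. finite J \<and> J \<subseteq> I \<and> definable s J P"
    and C: "subset.chain \<A> C" "C \<noteq> {}" "\<And>G. G \<in> C \<Longrightarrow> fin_sat s I \<Gamma> G"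
  shows "fin_sat s I \<Gamma> (\<Union>C)"
  unfolding fin_sat_def
proof (intro conjI allI impI)
  show "Domain (\<Union>C) \<subseteq> I" using C(3) by (auto simp: fin_sat_def)
  have member: "\<exists>g\<in>assigns s I. (\<forall>i a. (i, a) \<in> F \<longrightarrow> g i = a) \<and> (\<forall>P\<in>\<Gamma>0. P g)"
    if F: "finite F" "F \<subseteq> \<Union>C" and "finite \<Gamma>0" "\<Gamma>0 \<subseteq> \<Gamma>" for F \<Gamma>0
  proof -
    obtain G where "G \<in> C" "F \<subseteq> G" using finite_subset_Union_chain[OF F C(2,1)] .
    obtain g where "g \<in> assigns s I" "\<forall>i a. (i, a) \<in> G \<longrightarrow> g i = a" "\<forall>P\<in>\<Gamma>0. P g"
      using fin_satD[OF C(3)[OF \<open>G \<in> C\<close>] \<open>finite \<Gamma>0\<close> \<open>\<Gamma>0 \<subseteq> \<Gamma>\<close>] .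
    moreover from this have "\<forall>i a. (i, a) \<in> F \<longrightarrow> g i = a" using \<open>F \<subseteq> G\<close> by blast
    ultimately show ?thesis by (intro bexI[of _ g] conjI)
  qed
  have single: "a = b" if "(i, a) \<in> \<Union>C" "(i, b) \<in> \<Union>C" for i a b
    using member[of "{(i, a), (i, b)}" "{}"] that by auto
  fix \<Gamma>0 assume \<Gamma>0: "finite \<Gamma>0 \<and> \<Gamma>0 \<subseteq> \<Gamma>"
  obtain J where J: "finite J" "J \<subseteq> I" "\<forall>P\<in>\<Gamma>0. definable s J P"
    using common_support[of \<Gamma>0 I s] supp \<Gamma>0 by blast
  define F where "F = {p \<in> \<Union>C. fst p \<in> J}"
  have "inj_on fst F" using single by (fastforce simp: F_def inj_on_def)
  moreover have "fst ` F \<subseteq> J" by (auto simp: F_def)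
  ultimately have "finite F" using J(1) finite_imageD finite_subset by blast
  moreover have "F \<subseteq> \<Union>C" by (auto simp: F_def)
  ultimately have "\<exists>g\<in>assigns s I. (\<forall>i a. (i, a) \<in> F \<longrightarrow> g i = a) \<and> (\<forall>P\<in>\<Gamma>0. P g)"
    using \<Gamma>0 by (intro member) auto
  then obtain g where g: "g \<in> assigns s I" "\<forall>i a. (i, a) \<in> F \<longrightarrow> g i = a" "\<forall>P\<in>\<Gamma>0. P g"
    by blast
  define k where "k i = (if i \<in> Domain (\<Union>C) then (THE a. (i, a) \<in> \<Union>C) else g i)" for i
  have k: "k i = a" if "(i, a) \<in> \<Union>C" for i a
  proof -
    have "(THE a. (i, a) \<in> \<Union>C) = a" using that single by (intro the_equality) auto
    then show ?thesis using that unfolding k_def by (auto simp: Domain_iff)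
  qed
  have "k \<in> assigns s I"
    unfolding assigns_def
  proof (intro CollectI ballI)
    fix i assume i: "i \<in> I"
    show "k i \<in> univ M \<and> sort_of M (k i) = s i"
    proof (cases "i \<in> Domain (\<Union>C)")
      case True
      then obtain a where a: "(i, a) \<in> \<Union>C" by blast
      then show ?thesis using k[OF a] member[of "{(i, a)}" "{}"] i by (auto simp: assigns_def)
    next
      case False
      then have "k i = g i" by (simp add: k_def)
      then show ?thesis using g(1) i by (simp add: assigns_def)
    qed
  qed
  moreover have "P k" if P: "P \<in> \<Gamma>0" for P
  proof -
    have "g i = k i" if "i \<in> J" for i
    proof (cases "i \<in> Domain (\<Union>C)")
      case True
      then obtain a where a: "(i, a) \<in> \<Union>C" by blast
      then show ?thesis using k[OF a] g(2) that by (auto simp: F_def)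
    qed (simp add: k_def)
    then have "P g \<longleftrightarrow> P k" using definable_cong J P assigns_mono[OF g(1) J(2)] by blast
    then show ?thesis using g(3) P by blast
  qed
  ultimately show "\<exists>g\<in>assigns s I. (\<forall>i a. (i, a) \<in> \<Union>C \<longrightarrow> g i = a) \<and> (\<forall>P\<in>\<Gamma>0. P g)"
    using k by (intro bexI[of _ k]) auto
qed

text \<open>A maximal finitely satisfiable partial assignment is total, for otherwise saturation
  would give a value at one more index. A total one leaves its solutions no freedom on
  \<open>I\<close>, so satisfying each single condition is the same as satisfying all of
  them.\<close>

lemma compactness:
  fixes I :: "'i set"
  assumes few: "few I" and sorts: "s ` I \<subseteq> sorts L"
    and supp: "\<And>P. P \<in> \<Gamma> \<Longrightarrow> \<exists>J. finite J \<and> J \<subseteq> I \<and> definable s J P"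
    and D: "D \<subseteq> I"
    and fin: "\<And>\<Gamma>0. finite \<Gamma>0 \<Longrightarrow> \<Gamma>0 \<subseteq> \<Gamma> \<Longrightarrow>
      \<exists>g\<in>assigns s I. (\<forall>i\<in>D. g i = f i) \<and> (\<forall>P\<in>\<Gamma>0. P g)"
  shows "\<exists>g\<in>assigns s I. (\<forall>i\<in>D. g i = f i) \<and> (\<forall>P\<in>\<Gamma>. P g)"
proof -
  let ?G0 = "(\<lambda>i. (i, f i)) ` D"
  let ?\<A> = "{G. fin_sat s I \<Gamma> G \<and> ?G0 \<subseteq> G}"
  have graph: "(\<forall>i a. (i, a) \<in> ?G0 \<longrightarrow> g i = a) \<longleftrightarrow> (\<forall>i\<in>D. g i = f i)" for g :: "'i \<Rightarrow> 'a" by auto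
  have "fin_sat s I \<Gamma> ?G0"
    unfolding fin_sat_def graph
  proof (intro conjI allI impI)
    show "Domain ?G0 \<subseteq> I" using D by auto
  qed (elim conjE, rule fin)
  then have "?\<A> \<noteq> {}" by blast
  moreover have "\<Union>C \<in> ?\<A>" if C: "C \<noteq> {}" "subset.chain ?\<A> C" for C
  proof -
    have mem: "fin_sat s I \<Gamma> G \<and> ?G0 \<subseteq> G" if "G \<in> C" for G
      using C(2) that by (auto simp: subset.chain_def)
    then have "fin_sat s I \<Gamma> (\<Union>C)" using fin_sat_Union_chain[OF supp C(2,1)] by blast
    then show ?thesis using mem C(1) by blast
  qed
  ultimately have "\<exists>G\<in>?\<A>. \<forall>X\<in>?\<A>. G \<subseteq> X \<longrightarrow> X = G" by (rule subset_Zorn_nonempty)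
  then obtain G where "G \<in> ?\<A>" and max: "\<forall>X\<in>?\<A>. G \<subseteq> X \<longrightarrow> X = G" ..
  then have G: "fin_sat s I \<Gamma> G" "?G0 \<subseteq> G" by simp_all
  have dom: "I \<subseteq> Domain G"
  proof
    fix i assume "i \<in> I"
    then obtain a where "fin_sat s I \<Gamma> (insert (i, a) G)"
      using fin_sat_extend[OF few sorts supp G(1)] by blast
    then have "insert (i, a) G = G" using max G(2) by (simp add: subset_insertI2 subset_insertI)
    then show "i \<in> Domain G" by blast
  qed
  obtain g where g: "g \<in> assigns s I" "\<And>i a. (i, a) \<in> G \<Longrightarrow> g i = a"
    using fin_sat_assign[OF G(1)] by blast
  have "P g" if P: "P \<in> \<Gamma>" for P
  proof -
    obtain k where k: "k \<in> assigns s I" "\<forall>i a. (i, a) \<in> G \<longrightarrow> k i = a" "\<forall>P\<in>{P}. P k"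
      by (rule fin_satD[OF G(1), of "{P}"]) (use P in auto)
    obtain J where J: "finite J" "J \<subseteq> I" "definable s J P" using supp[OF P] by blast
    have "k i = g i" if "i \<in> J" for i using that J(2) dom g(2) k(2) by blast
    then show ?thesis using definable_cong[OF J(3,1) assigns_mono[OF k(1) J(2)]] k(3) by blast
  qed
  then show ?thesis using g G(2) by (intro bexI[of _ g]) auto
qed

end

section \<open>Elementary relations and automorphisms\<close>

context fo_struct
begin

lemma automorphism_eval:
  assumes \<sigma>: "automorphism L M \<sigma>"
  shows "wf_tm L t \<Longrightarrow> e \<in> assigns snd (tm_vars t) \<Longrightarrow> eval M (\<sigma> \<circ> e) t = \<sigma> (eval M e t)"
proof (induction t)
  case (Fun f ts)
  have ts: "wf_tm L t" "e \<in> assigns snd (tm_vars t)" if "t \<in> set ts" for t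
    using Fun.prems that by (auto simp: list_all_iff assigns_def)
  let ?as = "map (eval M e) ts"
  have "map (sort_of M) ?as = map (tm_sort L) ts" using eval_closed ts by simp
  also have "\<dots> = fargs L f" using Fun.prems by simp
  finally have "map (sort_of M) ?as = fargs L f" .
  moreover have "set ?as \<subseteq> univ M" using eval_closed ts by auto
  moreover have "f \<in> fsyms L" using Fun.prems by simp
  ultimately have "\<sigma> (fint M f ?as) = fint M f (map \<sigma> ?as)" using \<sigma> unfolding automorphism_def by blast
  moreover have "map (eval M (\<sigma> \<circ> e)) ts = map \<sigma> ?as" using Fun.IH ts by (simp add: comp_def)
  ultimately show ?case by (metis eval.simps(2))
qed simp

lemma automorphism_sat:
  assumes \<sigma>: "automorphism L M \<sigma>"
  shows "wf_fm L \<phi> \<Longrightarrow> e \<in> assigns snd (fv \<phi>) \<Longrightarrow> sat M (\<sigma> \<circ> e) \<phi> \<longleftrightarrow> sat M e \<phi>"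
proof (induction \<phi> arbitrary: e)
  case (Eq t u)
  have t: "wf_tm L t" "e \<in> assigns snd (tm_vars t)" and u: "wf_tm L u" "e \<in> assigns snd (tm_vars u)"
    using Eq.prems by (auto simp: assigns_def)
  have "inj_on \<sigma> (univ M)" using \<sigma> by (simp add: automorphism_def bij_betw_def)
  then show ?case
    using automorphism_eval[OF \<sigma> t] automorphism_eval[OF \<sigma> u] eval_closed[OF t] eval_closed[OF u]
    by (simp add: comp_def inj_on_eq_iff)
next
  case (Rel P ts)
  have ts: "wf_tm L t" "e \<in> assigns snd (tm_vars t)" if "t \<in> set ts" for t
    using Rel.prems that by (auto simp: list_all_iff assigns_def)
  let ?as = "map (eval M e) ts"
  have "map (sort_of M) ?as = map (tm_sort L) ts" using eval_closed ts by simp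
  also have "\<dots> = pargs L P" using Rel.prems by simp
  finally have "map (sort_of M) ?as = pargs L P" .
  moreover have "set ?as \<subseteq> univ M" using eval_closed ts by auto
  moreover have "P \<in> psyms L" using Rel.prems by simp
  ultimately have "pint M P (map \<sigma> ?as) \<longleftrightarrow> pint M P ?as" using \<sigma> unfolding automorphism_def by blast
  moreover have "map (eval M (\<sigma> \<circ> e)) ts = map \<sigma> ?as" using automorphism_eval[OF \<sigma>] ts by (simp add: comp_def)
  ultimately show ?case by (metis sat.simps(3))
next
  case (Imp \<phi> \<psi>)
  have "e \<in> assigns snd (fv \<phi>)" "e \<in> assigns snd (fv \<psi>)"
    using Imp.prems(2) by (auto intro: assigns_mono)
  then show ?case using Imp by simp
next
  case (All v \<phi>)
  have IH: "sat M ((\<sigma> \<circ> e)(v := \<sigma> a)) \<phi> \<longleftrightarrow> sat M (e(v := a)) \<phi>"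
    if "a \<in> univ M" "sort_of M a = snd v" for a
  proof -
    have "e(v := a) \<in> assigns snd (fv \<phi>)" using All.prems(2) that by (auto simp: assigns_def)
    moreover have "(\<sigma> \<circ> e)(v := \<sigma> a) = \<sigma> \<circ> e(v := a)" by auto
    ultimately show ?thesis using All.IH[of "e(v := a)"] All.prems(1) by (simp add: comp_def fun_upd_def)
  qed
  have sort: "sort_of M (\<sigma> a) = sort_of M a" if "a \<in> univ M" for a
    using \<sigma> that by (simp add: automorphism_def)
  have img: "univ M = \<sigma> ` univ M" using \<sigma> by (simp add: automorphism_def bij_betw_def)
  have "sat M (\<sigma> \<circ> e) (All v \<phi>) \<longleftrightarrow>
      (\<forall>a\<in>\<sigma> ` univ M. sort_of M a = snd v \<longrightarrow> sat M ((\<sigma> \<circ> e)(v := a)) \<phi>)" using img by simp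
  also have "\<dots> \<longleftrightarrow> sat M e (All v \<phi>)" using IH sort by simp
  finally show ?case .
qed simp

text \<open>Partial elementary maps. As sets of pairs they can be inverted and are closed under
  unions of chains. Variables are assigned pairs, so that one \<open>e\<close> carries the
  corresponding assignments on both sides.\<close>

definition elementary :: "('a \<times> 'a) set \<Rightarrow> bool" where
  "elementary R \<longleftrightarrow> R \<subseteq> univ M \<times> univ M \<and> (\<forall>a b. (a, b) \<in> R \<longrightarrow> sort_of M a = sort_of M b) \<and>
    (\<forall>\<phi> e. wf_fm L \<phi> \<and> (\<forall>v\<in>fv \<phi>. e v \<in> R \<and> sort_of M (fst (e v)) = snd v) \<and>
      sat M (fst \<circ> e) \<phi> \<longrightarrow> sat M (snd \<circ> e) \<phi>)"

lemma elementaryD: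
  assumes "elementary R" "(a, b) \<in> R"
  shows "a \<in> univ M" "b \<in> univ M" "sort_of M a = sort_of M b"
  using assms by (auto simp: elementary_def)

text \<open>The implication in the definition, applied to the negated formula, gives the
  converse.\<close>

lemma elementary_sat:
  assumes R: "elementary R" and \<phi>: "wf_fm L \<phi>"
    and e: "\<And>v. v \<in> fv \<phi> \<Longrightarrow> e v \<in> R \<and> sort_of M (fst (e v)) = snd v"
  shows "sat M (fst \<circ> e) \<phi> \<longleftrightarrow> sat M (snd \<circ> e) \<phi>"
proof
  show "sat M (fst \<circ> e) \<phi> \<Longrightarrow> sat M (snd \<circ> e) \<phi>" using assms unfolding elementary_def by blast
  have "sat M (fst \<circ> e) (Neg \<phi>) \<longrightarrow> sat M (snd \<circ> e) (Neg \<phi>)"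
    using R \<phi> e unfolding elementary_def by (metis Un_empty_right fv.simps(1,4) wf_fm.simps(1,4))
  then show "sat M (snd \<circ> e) \<phi> \<Longrightarrow> sat M (fst \<circ> e) \<phi>" by auto
qed

lemma elementary_converse:
  assumes R: "elementary R"
  shows "elementary (R\<inverse>)"
  unfolding elementary_def
proof (intro conjI allI impI)
  show "R\<inverse> \<subseteq> univ M \<times> univ M" using R by (auto dest: elementaryD)
  show "sort_of M a = sort_of M b" if "(a, b) \<in> R\<inverse>" for a b
    using that elementaryD[OF R, of b a] by simp
  fix \<phi> e
  assume *: "wf_fm L \<phi> \<and> (\<forall>v\<in>fv \<phi>. e v \<in> R\<inverse> \<and> sort_of M (fst (e v)) = snd v) \<and> sat M (fst \<circ> e) \<phi>"
  have "sat M (fst \<circ> (prod.swap \<circ> e)) \<phi> \<longleftrightarrow> sat M (snd \<circ> (prod.swap \<circ> e)) \<phi>"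
  proof (rule elementary_sat[OF R])
    fix v assume "v \<in> fv \<phi>"
    then have v: "e v \<in> R\<inverse>" "sort_of M (fst (e v)) = snd v" using * by auto
    obtain a b where ab: "e v = (a, b)" by fastforce
    then have "(b, a) \<in> R" using v by simp
    then show "(prod.swap \<circ> e) v \<in> R \<and> sort_of M (fst ((prod.swap \<circ> e) v)) = snd v"
      using v ab elementaryD[OF R, of b a] by simp
  qed (use * in simp)
  moreover have "fst \<circ> (prod.swap \<circ> e) = snd \<circ> e" "snd \<circ> (prod.swap \<circ> e) = fst \<circ> e" by auto
  ultimately show "sat M (snd \<circ> e) \<phi>" using * by simp
qed

text \<open>Elementarity for \<open>x = y\<close>, a formula that is well formed only between equal
  sorts; elements of different sorts stay different because sorts are preserved. This makes
  \<open>R\<close> and its converse single-valued.\<close>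

lemma elementary_eq_iff:
  assumes R: "elementary R" and ab: "(a, b) \<in> R" and cd: "(c, d) \<in> R"
  shows "a = c \<longleftrightarrow> b = d"
proof (cases "sort_of M a = sort_of M c")
  case True
  let ?s = "sort_of M a"
  let ?e = "\<lambda>v :: 's vbl. if fst v = 0 then (a, b) else (c, d)"
  let ?\<phi> = "Eq (Var (0, ?s)) (Var (1, ?s))"
  have "?s \<in> sorts L" using elementaryD[OF R ab] struct by (auto simp: is_struct_def)
  then have "sat M (fst \<circ> ?e) ?\<phi> \<longleftrightarrow> sat M (snd \<circ> ?e) ?\<phi>"
    using ab cd True by (intro elementary_sat[OF R]) auto
  then show ?thesis by simp
next
  case False
  then show ?thesis using elementaryD(3)[OF R ab] elementaryD(3)[OF R cd] by auto
qed

lemma elementary_Union_chain: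
  assumes C: "subset.chain \<A> C" "C \<noteq> {}" "\<And>R. R \<in> C \<Longrightarrow> elementary R"
  shows "elementary (\<Union>C)"
  unfolding elementary_def
proof (intro conjI allI impI)
  show "\<Union>C \<subseteq> univ M \<times> univ M" using C(3) by (auto dest: elementaryD)
  show "sort_of M a = sort_of M b" if "(a, b) \<in> \<Union>C" for a b
    using that C(3) elementaryD(3) by blast
  fix \<phi> :: "('s, 'f, 'p) fm" and e
  assume *: "wf_fm L \<phi> \<and> (\<forall>v\<in>fv \<phi>. e v \<in> \<Union>C \<and> sort_of M (fst (e v)) = snd v) \<and> sat M (fst \<circ> e) \<phi>"
  then have "finite (e ` fv \<phi>)" "e ` fv \<phi> \<subseteq> \<Union>C" by auto
  then obtain R where "R \<in> C" "e ` fv \<phi> \<subseteq> R" using finite_subset_Union_chain[OF _ _ C(2,1)] by metis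
  then show "sat M (snd \<circ> e) \<phi>" using elementary_sat[OF C(3), of R \<phi> e] * by blast
qed

lemma elementary_definable:
  assumes R: "elementary R" and J: "finite J" "\<And>j. j \<in> J \<Longrightarrow> (j, f j) \<in> R"
    and P: "definable (sort_of M) J P" "P id"
  shows "P f"
proof -
  obtain w :: "'a \<Rightarrow> 's vbl" where w: "inj_on w J" "\<And>j. snd (w j) = sort_of M j"
    using ex_vars[OF J(1), of "sort_of M"] by metis
  obtain \<phi> where \<phi>: "wf_fm L \<phi>" "fv \<phi> \<subseteq> w ` J"
    "\<And>g h. g \<in> assigns (sort_of M) J \<Longrightarrow> (\<And>j. j \<in> J \<Longrightarrow> h (w j) = g j) \<Longrightarrow> P g \<longleftrightarrow> sat M h \<phi>"
    using definableE[OF P(1) w] by metis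
  define e where "e v = (inv_into J w v, f (inv_into J w v))" for v
  have ew: "e (w j) = (j, f j)" if "j \<in> J" for j using that w by (simp add: e_def)
  have fa: "f \<in> assigns (sort_of M) J" and ida: "id \<in> assigns (sort_of M) J"
    using elementaryD[OF R J(2)] by (auto simp: assigns_def)
  have "P id \<longleftrightarrow> sat M (fst \<circ> e) \<phi>" by (rule \<phi>(3)[OF ida]) (simp add: ew)
  also have "\<dots> \<longleftrightarrow> sat M (snd \<circ> e) \<phi>"
    using \<phi>(2) ew J(2) w(2) by (intro elementary_sat[OF R \<phi>(1)]) fastforce
  also have "\<dots> \<longleftrightarrow> P f" by (rule \<phi>(3)[OF fa, symmetric]) (simp add: ew)
  finally show ?thesis using P(2) by simp
qed

text \<open>Compatibility with the symbols is elementarity for the atomic formulas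
  \<open>f(x_0, ..., x_{n-1}) = x_n\<close> and \<open>P(x_0, ..., x_{n-1})\<close>, where the
  number is the name of the variable. Bijectivity comes from elementarity of equality and from
  \<open>R\<close> having full domain and range.\<close>

lemma automorphism_of_elementary:
  assumes R: "elementary R" and dom: "Domain R = univ M" "Range R = univ M"
  shows "\<exists>\<sigma>. automorphism L M \<sigma> \<and> (\<forall>(a, b)\<in>R. \<sigma> a = b)"
proof -
  have "\<forall>a\<in>univ M. \<exists>b. (a, b) \<in> R" using dom(1) by blast
  then obtain \<sigma> where \<sigma>: "\<And>a. a \<in> univ M \<Longrightarrow> (a, \<sigma> a) \<in> R" by metis
  have \<sigma>_eq: "\<sigma> a = b" if "(a, b) \<in> R" for a b
    using elementary_eq_iff[OF R that \<sigma>] elementaryD[OF R that] by blast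
  have \<sigma>D: "\<sigma> a \<in> univ M" "sort_of M (\<sigma> a) = sort_of M a" if "a \<in> univ M" for a
    using elementaryD[OF R \<sigma>[OF that]] by simp_all
  have "inj_on \<sigma> (univ M)" using elementary_eq_iff[OF R \<sigma> \<sigma>] by (auto intro: inj_onI)
  moreover have "\<sigma> ` univ M = univ M"
  proof
    show "\<sigma> ` univ M \<subseteq> univ M" using \<sigma>D by auto
    show "univ M \<subseteq> \<sigma> ` univ M"
    proof
      fix b assume "b \<in> univ M"
      then obtain a where a: "(a, b) \<in> R" using dom(2) by blast
      then show "b \<in> \<sigma> ` univ M" using \<sigma>_eq[OF a] elementaryD[OF R a] by blast
    qed
  qed
  ultimately have bij: "bij_betw \<sigma> (univ M) (univ M)" by (simp add: bij_betw_def)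
  have transfer: "sat M e \<phi> \<longleftrightarrow> sat M (\<sigma> \<circ> e) \<phi>"
    if "wf_fm L \<phi>" "e \<in> assigns snd (fv \<phi>)" for \<phi> e
  proof -
    have "sat M (fst \<circ> (\<lambda>v. (e v, \<sigma> (e v)))) \<phi> \<longleftrightarrow> sat M (snd \<circ> (\<lambda>v. (e v, \<sigma> (e v)))) \<phi>"
      using that \<sigma> by (intro elementary_sat[OF R]) (auto simp: assigns_def)
    then show ?thesis by (simp add: comp_def)
  qed
  have "\<sigma> (fint M f as) = fint M f (map \<sigma> as)"
    if f: "f \<in> fsyms L" and as: "set as \<subseteq> univ M" "map (sort_of M) as = fargs L f" for f as
  proof -
    let ?n = "length as"
    let ?vs = "map (\<lambda>i. (i, fargs L f ! i)) [0..<?n]"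
    let ?\<phi> = "Eq (Fun f (map Var ?vs)) (Var (?n, fres L f))"
    let ?e = "\<lambda>v. if fst v < ?n then as ! fst v else fint M f as"
    have len: "length (fargs L f) = ?n" using as(2) by (metis length_map)
    have nth: "sort_of M (as ! i) = fargs L f ! i" if "i < ?n" for i using as(2) that by (metis nth_map)
    have sorts: "set (fargs L f) \<subseteq> sorts L" "fres L f \<in> sorts L"
      using lang f by (auto simp: is_lang_def)
    have res: "fint M f as \<in> univ M" "sort_of M (fint M f as) = fres L f"
      using struct f as unfolding is_struct_def by blast+
    have "map (tm_sort L) (map Var ?vs) = fargs L f" using len by (auto intro: nth_equalityI)
    then have wf: "wf_fm L ?\<phi>" using f sorts len by (auto simp: list_all_iff)
    have "?e \<in> assigns snd (fv ?\<phi>)" using as(1) nth res by (auto simp: assigns_def)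
    with transfer[OF wf] have "sat M ?e ?\<phi> \<longleftrightarrow> sat M (\<sigma> \<circ> ?e) ?\<phi>" by blast
    moreover have "map (eval M ?e) (map Var ?vs) = as" by (auto intro: nth_equalityI)
    moreover have "map (eval M (\<sigma> \<circ> ?e)) (map Var ?vs) = map \<sigma> as" by (auto intro: nth_equalityI)
    ultimately show ?thesis by (simp del: map_map)
  qed
  moreover have "pint M P (map \<sigma> as) \<longleftrightarrow> pint M P as"
    if P: "P \<in> psyms L" and as: "set as \<subseteq> univ M" "map (sort_of M) as = pargs L P" for P as
  proof -
    let ?n = "length as"
    let ?vs = "map (\<lambda>i. (i, pargs L P ! i)) [0..<?n]"
    let ?\<phi> = "Rel P (map Var ?vs)"
    let ?e = "\<lambda>v. as ! fst v"
    have len: "length (pargs L P) = ?n" using as(2) by (metis length_map)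
    have nth: "sort_of M (as ! i) = pargs L P ! i" if "i < ?n" for i using as(2) that by (metis nth_map)
    have sorts: "set (pargs L P) \<subseteq> sorts L" using lang P by (auto simp: is_lang_def)
    have "map (tm_sort L) (map Var ?vs) = pargs L P" using len by (auto intro: nth_equalityI)
    then have wf: "wf_fm L ?\<phi>" using P sorts len by (auto simp: list_all_iff)
    have "?e \<in> assigns snd (fv ?\<phi>)" using as(1) nth by (auto simp: assigns_def)
    with transfer[OF wf] have "sat M ?e ?\<phi> \<longleftrightarrow> sat M (\<sigma> \<circ> ?e) ?\<phi>" by blast
    moreover have "map (eval M ?e) (map Var ?vs) = as" by (auto intro: nth_equalityI)
    moreover have "map (eval M (\<sigma> \<circ> ?e)) (map Var ?vs) = map \<sigma> as" by (auto intro: nth_equalityI)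
    ultimately show ?thesis by (simp del: map_map)
  qed
  ultimately have "automorphism L M \<sigma>" using bij \<sigma>D by (simp add: automorphism_def)
  then show ?thesis using \<sigma>_eq by blast
qed

lemma few_inj: "inj_on f A \<Longrightarrow> few (f ` A) \<Longrightarrow> few A"
  using few_image[of "f ` A" "inv_into A f"] by simp

end

section \<open>Homogeneity by back and forth\<close>

context saturated_struct
begin

text \<open>Compactness is applied to everything true of \<open>I\<close> under the identity, with
  the values on \<open>Domain R\<close> prescribed by \<open>R\<close>. A finite part is solvable
  because its solvability is a definable property of elements of \<open>Domain R\<close>: the
  identity shows that it holds on the left, so it holds on the right by elementarity.\<close>

lemma elementary_extend:
  assumes R: "elementary R" and few: "few R" and a: "a \<in> univ M"
  shows "\<exists>b. elementary (insert (a, b) R)"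
proof -
  let ?s = "sort_of M"
  define I where "I = insert a (Domain R)"
  define \<Gamma> where "\<Gamma> = {P. \<exists>\<phi> e. P = (\<lambda>g. sat M (g \<circ> e) \<phi>) \<and> wf_fm L \<phi> \<and>
    (\<forall>v\<in>fv \<phi>. e v \<in> I \<and> ?s (e v) = snd v) \<and> sat M e \<phi>}"
  have "\<forall>j\<in>Domain R. \<exists>b. (j, b) \<in> R" by blast
  then obtain f where f: "\<And>j. j \<in> Domain R \<Longrightarrow> (j, f j) \<in> R" by metis
  have f_eq: "f j = b" if "(j, b) \<in> R" for j b
    using elementary_eq_iff[OF R that f] that by blast
  have "Domain R = fst ` R" by force
  then have fewI: "few I" using few_Un[OF few_image[OF few, of fst], of "{a}"] by (simp add: I_def few_def)
  have I: "I \<subseteq> univ M" using a R by (auto simp: I_def dest: elementaryD)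
  then have sorts: "?s ` I \<subseteq> sorts L" using struct by (auto simp: is_struct_def)
  have supp: "\<exists>J. finite J \<and> J \<subseteq> I \<and> definable ?s J P" if "P \<in> \<Gamma>" for P
  proof -
    from that obtain \<phi> e where P: "P = (\<lambda>g. sat M (g \<circ> e) \<phi>)" "wf_fm L \<phi>"
      "\<forall>v\<in>fv \<phi>. e v \<in> I \<and> ?s (e v) = snd v" unfolding \<Gamma>_def by blast
    then have "definable ?s (e ` fv \<phi>) P" using definable_sat[of \<phi> e "e ` fv \<phi>"] by simp
    then show ?thesis using P(3) by (intro exI[of _ "e ` fv \<phi>"]) auto
  qed
  have "\<exists>g\<in>assigns ?s I. (\<forall>i\<in>Domain R. g i = f i) \<and> (\<forall>P\<in>\<Gamma>. P g)"
  proof (rule compactness[OF fewI sorts supp])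
    show "Domain R \<subseteq> I" by (auto simp: I_def)
    fix \<Gamma>0 assume \<Gamma>0: "finite \<Gamma>0" "\<Gamma>0 \<subseteq> \<Gamma>"
    obtain J where J: "finite J" "J \<subseteq> I" "\<forall>P\<in>\<Gamma>0. definable ?s J P"
      using common_support[of \<Gamma>0 I ?s] supp \<Gamma>0 by blast
    define P0 where "P0 g \<longleftrightarrow> (\<forall>P\<in>\<Gamma>0. P g)" for g
    have P0: "definable ?s J P0" unfolding P0_def[abs_def] using definable_Ball \<Gamma>0(1) J(3) by blast
    define J0 where "J0 = J \<inter> Domain R"
    define K where "K = J - Domain R"
    have JK: "J = J0 \<union> K" "J0 \<inter> K = {}" "finite J0" "finite K" "J0 \<subseteq> Domain R" "K \<inter> Domain R = {}"
      using J(1) by (auto simp: J0_def K_def)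
    define Q where "Q h \<longleftrightarrow> (\<exists>g'\<in>assigns ?s (J0 \<union> K). (\<forall>j\<in>J0. g' j = h j) \<and> P0 g')" for h
    have sK: "?s ` K \<subseteq> sorts L" using sorts J(2) JK(1) by blast
    have "definable ?s J0 Q"
      using definable_ex_set[OF JK(4,3,2) sK P0[unfolded JK(1)]] unfolding Q_def[abs_def] .
    moreover have "Q id"
    proof -
      have "P0 id" using \<Gamma>0(2) by (auto simp: P0_def \<Gamma>_def)
      moreover have "id \<in> assigns ?s (J0 \<union> K)" using J(2) JK(1) I by (auto simp: assigns_def)
      ultimately show ?thesis unfolding Q_def by (intro bexI[of _ id]) auto
    qed
    ultimately have "Q f"
      using elementary_definable[OF R JK(3), of f] f JK(5) by blast
    then obtain g' where g': "g' \<in> assigns ?s J" "\<forall>j\<in>J0. g' j = f j" "P0 g'"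
      unfolding Q_def JK(1) by blast
    \<comment> \<open>Within \<open>I\<close> the last default concerns only \<open>a\<close> when
      it lies outside the support \<open>J\<close>; any value of the right sort will do.\<close>
    define g where "g j = (if j \<in> Domain R then f j else if j \<in> J then g' j else j)" for j
    have "g j = g' j" if "j \<in> J" for j using that g'(2) by (auto simp: g_def J0_def)
    then have "P0 g" using definable_cong[OF P0 J(1) g'(1), of g] g'(3) by simp
    moreover have "g \<in> assigns ?s I"
      unfolding assigns_def
    proof (intro CollectI ballI)
      fix j assume j: "j \<in> I"
      show "g j \<in> univ M \<and> ?s (g j) = ?s j"
      proof (cases "j \<in> Domain R")
        case True
        then show ?thesis using elementaryD[OF R f[OF True]] by (simp add: g_def)
      next
        case False
        then show ?thesis using g'(1) I j by (auto simp: g_def assigns_def)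
      qed
    qed
    ultimately show "\<exists>g\<in>assigns ?s I. (\<forall>i\<in>Domain R. g i = f i) \<and> (\<forall>P\<in>\<Gamma>0. P g)"
      unfolding P0_def by (intro bexI[of _ g]) (auto simp: g_def)
  qed
  then obtain g where g: "g \<in> assigns ?s I" "\<forall>i\<in>Domain R. g i = f i" "\<forall>P\<in>\<Gamma>. P g" by blast
  have g_eq: "x \<in> I \<and> y = g x" if "(x, y) \<in> insert (a, g a) R" for x y
  proof (cases "(x, y) \<in> R")
    case True
    then have "x \<in> Domain R" by blast
    then show ?thesis using f_eq[OF True] g(2) by (simp add: I_def)
  next
    case False
    then show ?thesis using that by (simp add: I_def)
  qed
  have "elementary (insert (a, g a) R)"
    unfolding elementary_def
  proof (intro conjI allI impI)
    have "x \<in> univ M \<and> y \<in> univ M" if "(x, y) \<in> insert (a, g a) R" for x y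
      using g_eq[OF that] g(1) I by (auto simp: assigns_def)
    then show "insert (a, g a) R \<subseteq> univ M \<times> univ M" by (meson SigmaI subrelI)
    show "?s x = ?s y" if "(x, y) \<in> insert (a, g a) R" for x y
      using g_eq[OF that] g(1) by (auto simp: assigns_def)
    fix \<phi> :: "('s, 'f, 'p) fm" and e
    assume *: "wf_fm L \<phi> \<and> (\<forall>v\<in>fv \<phi>. e v \<in> insert (a, g a) R \<and> ?s (fst (e v)) = snd v) \<and>
      sat M (fst \<circ> e) \<phi>"
    have e: "fst (e v) \<in> I \<and> snd (e v) = g (fst (e v))" if "v \<in> fv \<phi>" for v
      using * that g_eq by (metis prod.collapse)
    then have "(\<lambda>g. sat M (g \<circ> (fst \<circ> e)) \<phi>) \<in> \<Gamma>"
      unfolding \<Gamma>_def using * by (intro CollectI exI[of _ \<phi>] exI[of _ "fst \<circ> e"]) auto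
    from bspec[OF g(3) this] have "sat M (g \<circ> (fst \<circ> e)) \<phi>" .
    moreover have "sat M (g \<circ> (fst \<circ> e)) \<phi> \<longleftrightarrow> sat M (snd \<circ> e) \<phi>"
      using e by (intro sat_cong) simp
    ultimately show "sat M (snd \<circ> e) \<phi>" by simp
  qed
  then show ?thesis ..
qed

text \<open>The back step is the forth step for the converse relation.\<close>

lemma elementary_back_and_forth:
  assumes R: "elementary R" and few: "few R" and a: "a \<in> univ M"
  shows "\<exists>b c. elementary (insert (c, a) (insert (a, b) R))"
proof -
  obtain b where b: "elementary (insert (a, b) R)" using elementary_extend[OF assms] by blast
  have "few (insert (a, b) R)" using few_Un[OF few, of "{(a, b)}"] by (simp add: few_def)
  moreover have "(insert (a, b) R)\<inverse> = prod.swap ` insert (a, b) R" by force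
  ultimately have "few ((insert (a, b) R)\<inverse>)" using few_image by metis
  then obtain c where "elementary (insert (a, c) ((insert (a, b) R)\<inverse>))"
    using elementary_extend[OF elementary_converse[OF b] _ a] by blast
  then have "elementary ((insert (a, c) ((insert (a, b) R)\<inverse>))\<inverse>)" by (rule elementary_converse)
  moreover have "(insert (a, c) ((insert (a, b) R)\<inverse>))\<inverse> = insert (c, a) (insert (a, b) R)" by auto
  ultimately show ?thesis by metis
qed

text \<open>Back and forth along a well-order of the universe of minimal order type. The initial
  segment \<open>covered R\<close> of elements already treated is read off the relation, so that Zorn's lemma
  applies to relations ordered by inclusion.\<close>

lemma elementary_total:
  assumes R0: "elementary R0" and few: "few R0"
  shows "\<exists>R. elementary R \<and> R0 \<subseteq> R \<and> Domain R = univ M \<and> Range R = univ M"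
proof -
  let ?r = "|univ M|"
  have wo: "well_order_on (univ M) ?r" by (rule card_of_well_order_on)
  have Fr: "Field ?r = univ M" by (rule Field_card_of)
  have refl: "(a, a) \<in> ?r" if "a \<in> univ M" for a
    using wo that unfolding well_order_on_def linear_order_on_def partial_order_on_def
      preorder_on_def by (blast dest: refl_onD)
  have trans: "(a, c) \<in> ?r" if "(a, b) \<in> ?r" "(b, c) \<in> ?r" for a b c
    using wo that unfolding well_order_on_def linear_order_on_def partial_order_on_def
      preorder_on_def by (blast dest: transD)
  have total: "a = b \<or> (a, b) \<in> ?r \<or> (b, a) \<in> ?r" if "a \<in> univ M" "b \<in> univ M" for a b
    using wo that unfolding well_order_on_def linear_order_on_def total_on_def by blast
  define covered where
    "covered R = {a \<in> univ M. \<forall>b. (b, a) \<in> ?r \<longrightarrow> b \<in> Domain R \<and> b \<in> Range R}" for R :: "('a \<times> 'a) set"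
  have covered_mono: "covered R \<subseteq> covered R'" if "R \<subseteq> R'" for R R'
    using that unfolding covered_def by blast
  have covered: "a \<in> Domain R" "a \<in> Range R" if "a \<in> covered R" for a R
    using that refl unfolding covered_def by blast+
  \<comment> \<open>The last clause bounds the size of \<open>R\<close>: every pair outside
    \<open>R0\<close> has a covered coordinate, and a coordinate determines its pair.\<close>
  define \<A> where "\<A> = {R. elementary R \<and> R0 \<subseteq> R \<and>
    (\<forall>a b. (a, b) \<in> R \<longrightarrow> (a, b) \<in> R0 \<or> a \<in> covered R \<or> b \<in> covered R)}"
  have "R0 \<in> \<A>" using R0 by (auto simp: \<A>_def)
  then have "\<A> \<noteq> {}" by blast
  moreover have "\<Union>C \<in> \<A>" if C: "C \<noteq> {}" "subset.chain \<A> C" for C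
  proof -
    have mem: "R \<in> \<A>" if "R \<in> C" for R using C(2) that by (auto simp: subset.chain_def)
    then have "elementary (\<Union>C)" using elementary_Union_chain[OF C(2,1)] by (simp add: \<A>_def)
    moreover have "R0 \<subseteq> \<Union>C" using C(1) mem unfolding \<A>_def by blast
    moreover have "(a, b) \<in> R0 \<or> a \<in> covered (\<Union>C) \<or> b \<in> covered (\<Union>C)" if "(a, b) \<in> \<Union>C" for a b
    proof -
      from that obtain R where R: "R \<in> C" "(a, b) \<in> R" by blast
      then show ?thesis using mem[OF R(1)] covered_mono[of R "\<Union>C"] unfolding \<A>_def by blast
    qed
    ultimately show ?thesis by (simp add: \<A>_def)
  qed
  ultimately have "\<exists>R\<in>\<A>. \<forall>X\<in>\<A>. R \<subseteq> X \<longrightarrow> X = R" by (rule subset_Zorn_nonempty)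
  then obtain R where RA: "R \<in> \<A>" and max: "\<forall>X\<in>\<A>. R \<subseteq> X \<longrightarrow> X = R" ..
  have R: "elementary R" "R0 \<subseteq> R"
    and new: "\<And>a b. (a, b) \<in> R \<Longrightarrow> (a, b) \<in> R0 \<or> a \<in> covered R \<or> b \<in> covered R"
    using RA by (auto simp: \<A>_def)
  have "covered R = univ M"
  proof (rule ccontr)
    assume "covered R \<noteq> univ M"
    then have "univ M - covered R \<noteq> {}" by (auto simp: covered_def)
    moreover have "wf (?r - Id)" using wo by (simp add: well_order_on_def)
    ultimately obtain a where "a \<in> univ M - covered R"
      and least: "\<And>b. (b, a) \<in> ?r - Id \<Longrightarrow> b \<notin> univ M - covered R" by (meson ex_in_conv wfE_min)
    then have a: "a \<in> univ M" "a \<notin> covered R" by auto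
    have below: "b \<in> covered R" if "(b, a) \<in> ?r" "b \<noteq> a" for b
      using least[of b] that Fr by (auto simp: Field_def)
    have "covered R \<subseteq> underS ?r a"
    proof
      fix c assume c: "c \<in> covered R"
      have "(a, c) \<notin> ?r"
      proof
        assume "(a, c) \<in> ?r"
        then have "a \<in> covered R" using c a(1) trans unfolding covered_def by blast
        then show False using a(2) by blast
      qed
      then show "c \<in> underS ?r a" using total[of a c] a c by (auto simp: underS_def covered_def)
    qed
    \<comment> \<open>Here the minimality of the order type is used: proper initial segments of a
      cardinal have smaller cardinality. Hence \<open>R\<close> is still few, and an extension step
      is possible.\<close>
    moreover have "few (underS ?r a)"
      unfolding few_def using card_of_underS[OF card_of_Card_order, of a "univ M"] a(1) Fr by simp
    ultimately have few_cov: "few (covered R)" using few_subset by blast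
    have "few {p \<in> R. fst p \<in> covered R}"
    proof (rule few_inj)
      show "inj_on fst {p \<in> R. fst p \<in> covered R}"
        using elementary_eq_iff[OF R(1)] by (auto simp: inj_on_def)
      show "few (fst ` {p \<in> R. fst p \<in> covered R})" using few_cov by (rule few_subset) auto
    qed
    moreover have "few {p \<in> R. snd p \<in> covered R}"
    proof (rule few_inj)
      show "inj_on snd {p \<in> R. snd p \<in> covered R}"
        using elementary_eq_iff[OF R(1)] by (auto simp: inj_on_def)
      show "few (snd ` {p \<in> R. snd p \<in> covered R})" using few_cov by (rule few_subset) auto
    qed
    ultimately have "few (R0 \<union> {p \<in> R. fst p \<in> covered R} \<union> {p \<in> R. snd p \<in> covered R})"
      using few few_Un by blast
    moreover have "R \<subseteq> R0 \<union> {p \<in> R. fst p \<in> covered R} \<union> {p \<in> R. snd p \<in> covered R}"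
      using new by (intro subrelI) simp
    ultimately have "few R" by (rule few_subset)
    from elementary_back_and_forth[OF R(1) this a(1)]
    obtain b c where bc: "elementary (insert (c, a) (insert (a, b) R))" by blast
    let ?R = "insert (c, a) (insert (a, b) R)"
    have cov: "covered R \<subseteq> covered ?R" by (rule covered_mono) auto
    \<comment> \<open>Everything below \<open>a\<close> was covered before, and the two new pairs
      put \<open>a\<close> into the domain and the range. So \<open>a\<close> becomes covered,
      against maximality.\<close>
    have "d \<in> Domain ?R \<and> d \<in> Range ?R" if "(d, a) \<in> ?r" for d
      using covered[OF below[OF that]] by (cases "d = a") auto
    then have a_cov: "a \<in> covered ?R" using a(1) by (simp add: covered_def)
    have "(x, y) \<in> R0 \<or> x \<in> covered ?R \<or> y \<in> covered ?R" if "(x, y) \<in> ?R" for x y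
    proof (cases "(x, y) \<in> R")
      case True
      then show ?thesis using new cov by blast
    next
      case False
      then show ?thesis using that a_cov by auto
    qed
    then have "?R \<in> \<A>" using bc R(2) by (simp add: \<A>_def subset_insertI2)
    moreover have "R \<subseteq> ?R" by auto
    ultimately have "?R = R" using max by blast
    then show False using a_cov a(2) by simp
  qed
  then have "univ M \<subseteq> Domain R" "univ M \<subseteq> Range R" using covered by blast+
  moreover have "Domain R \<subseteq> univ M" "Range R \<subseteq> univ M" using elementaryD[OF R(1)] by blast+
  ultimately show ?thesis using R by blast
qed

lemma homogeneous:
  assumes "elementary R" "few R"
  shows "\<exists>\<sigma>. automorphism L M \<sigma> \<and> (\<forall>(a, b)\<in>R. \<sigma> a = b)"
proof -
  obtain R' where R': "elementary R'" "R \<subseteq> R'" "Domain R' = univ M" "Range R' = univ M"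
    using elementary_total[OF assms] by blast
  obtain \<sigma> where "automorphism L M \<sigma>" "\<forall>(a, b)\<in>R'. \<sigma> a = b"
    using automorphism_of_elementary[OF R'(1,3,4)] by (elim exE conjE)
  then show ?thesis using R'(2) by (intro exI[of _ \<sigma>]) auto
qed

end

section \<open>Strong finite character\<close>

context saturated_struct
begin

lemma definable_automorphism:
  assumes \<sigma>: "automorphism L M \<sigma>" and J: "finite J" and P: "definable s J P" and g: "g \<in> assigns s J"
  shows "P (\<sigma> \<circ> g) \<longleftrightarrow> P g"
proof -
  obtain w :: "_ \<Rightarrow> 's vbl" where w: "inj_on w J" "\<And>j. snd (w j) = s j"
    using ex_vars[OF J, of s] by metis
  obtain \<phi> where \<phi>: "wf_fm L \<phi>" "fv \<phi> \<subseteq> w ` J"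
    "\<And>g h. g \<in> assigns s J \<Longrightarrow> (\<And>j. j \<in> J \<Longrightarrow> h (w j) = g j) \<Longrightarrow> P g \<longleftrightarrow> sat M h \<phi>"
    using definableE[OF P w] by metis
  define h where "h = g \<circ> inv_into J w"
  have h: "h (w j) = g j" if "j \<in> J" for j using that w(1) by (simp add: h_def)
  have "\<sigma> \<circ> g \<in> assigns s J"
    using g bij_betwE[of \<sigma> "univ M" "univ M"] \<sigma> by (auto simp: assigns_def automorphism_def)
  then have "P (\<sigma> \<circ> g) \<longleftrightarrow> sat M (\<sigma> \<circ> h) \<phi>" by (rule \<phi>(3)) (simp add: h)
  also have "\<dots> \<longleftrightarrow> sat M h \<phi>"
    using \<phi>(2) g h w(2) by (intro automorphism_sat[OF \<sigma> \<phi>(1)]) (fastforce simp: assigns_def)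
  also have "\<dots> \<longleftrightarrow> P g" by (rule \<phi>(3)[OF g, symmetric]) (simp add: h)
  finally show ?thesis .
qed

text \<open>Conditions on a copy of \<open>A\<close> over a set of parameters: an element \<open>a\<close> of \<open>A\<close> is represented
  by the index \<open>Inl a\<close>, a parameter \<open>b\<close> by \<open>Inr b\<close>. The conditions in \<open>ind_conds\<close> are the negations
  of the formulas that force dependence.\<close>

abbreviation sort2 :: "'a + 'a \<Rightarrow> 's" where
  "sort2 \<equiv> case_sum (sort_of M) (sort_of M)"

definition type_conds :: "'a set \<Rightarrow> 'a set \<Rightarrow> (('a + 'a \<Rightarrow> 'a) \<Rightarrow> bool) set" where
  "type_conds A B = {P. \<exists>J. finite J \<and> J \<subseteq> Inl ` A \<union> Inr ` B \<and> definable sort2 J P \<and>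
    P (case_sum id id)}"

definition ind_conds :: "'a ternary \<Rightarrow> 'a set \<Rightarrow> 'a set \<Rightarrow> 'a set \<Rightarrow> (('a + 'a \<Rightarrow> 'a) \<Rightarrow> bool) set" where
  "ind_conds ind A C B = {P. \<exists>J. finite J \<and> J \<subseteq> Inl ` A \<union> Inr ` (B \<union> C) \<and> definable sort2 J P \<and>
    (\<forall>g\<in>assigns sort2 J. (\<forall>d\<in>B \<union> C. g (Inr d) = d) \<and> \<not> P g \<longrightarrow>
      \<not> ind (g ` (J \<inter> range Inl)) C B)}"

lemma few_image_Plus: "few A \<Longrightarrow> few B \<Longrightarrow> few (Inl ` A \<union> Inr ` B)"
  by (intro few_Un few_image)

text \<open>Matching the copy with \<open>A\<close> and every parameter with itself is elementary:
  if a formula held of the copy but not of the original, its negation would be one of the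
  conditions. Homogeneity extends this matching to an automorphism.\<close>

lemma type_conds_realized:
  assumes small: "small M A" "small M B"
    and g: "g \<in> assigns sort2 (Inl ` A \<union> Inr ` B)" "\<And>b. b \<in> B \<Longrightarrow> g (Inr b) = b"
    and conds: "\<forall>P\<in>type_conds A B. P g"
  shows "equiv_over L M B (g ` Inl ` A) A"
proof -
  let ?I = "Inl ` A \<union> Inr ` B :: ('a + 'a) set" and ?val = "case_sum id id :: 'a + 'a \<Rightarrow> 'a"
  define R where "R = (\<lambda>i. (g i, ?val i)) ` ?I"
  have AB: "A \<subseteq> univ M" "B \<subseteq> univ M" "few A" "few B" using small by (auto simp: small_iff)
  have gi: "g i \<in> univ M" "sort_of M (g i) = sort2 i" if "i \<in> ?I" for i
    using g(1) that unfolding assigns_def by blast+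
  have val: "?val i \<in> univ M" "sort_of M (?val i) = sort2 i" if "i \<in> ?I" for i using that AB by auto
  have "elementary R"
    unfolding elementary_def
  proof (intro conjI allI impI)
    show "R \<subseteq> univ M \<times> univ M" using gi(1) val(1) unfolding R_def by blast
    show "sort_of M a = sort_of M b" if "(a, b) \<in> R" for a b
      using that gi(2) val(2) unfolding R_def by fastforce
    fix \<phi> :: "('s, 'f, 'p) fm" and e
    assume *: "wf_fm L \<phi> \<and> (\<forall>v\<in>fv \<phi>. e v \<in> R \<and> sort_of M (fst (e v)) = snd v) \<and> sat M (fst \<circ> e) \<phi>"
    then have "\<forall>v\<in>fv \<phi>. \<exists>i. i \<in> ?I \<and> e v = (g i, ?val i)" unfolding R_def by blast
    then obtain k where k: "\<And>v. v \<in> fv \<phi> \<Longrightarrow> k v \<in> ?I \<and> e v = (g (k v), ?val (k v))" by metis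
    have sort: "sort2 (k v) = snd v" if "v \<in> fv \<phi>" for v using k[OF that] gi(2) * that by fastforce
    show "sat M (snd \<circ> e) \<phi>"
    proof (rule ccontr)
      assume "\<not> sat M (snd \<circ> e) \<phi>"
      moreover have "sat M (snd \<circ> e) \<phi> \<longleftrightarrow> sat M (?val \<circ> k) \<phi>" using k by (intro sat_cong) simp
      moreover have "definable sort2 (k ` fv \<phi>) (\<lambda>g. sat M (g \<circ> k) (Neg \<phi>))"
        using * sort by (intro definable_sat) auto
      ultimately have "(\<lambda>g. sat M (g \<circ> k) (Neg \<phi>)) \<in> type_conds A B"
        unfolding type_conds_def using k by (intro CollectI exI[of _ "k ` fv \<phi>"]) auto
      from bspec[OF conds this] have "\<not> sat M (g \<circ> k) \<phi>" by simp
      moreover have "sat M (fst \<circ> e) \<phi> \<longleftrightarrow> sat M (g \<circ> k) \<phi>" using k by (intro sat_cong) simp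
      ultimately show False using * by blast
    qed
  qed
  moreover have "few R" unfolding R_def using few_image[OF few_image_Plus[OF AB(3,4)]] .
  ultimately obtain \<sigma> where \<sigma>: "automorphism L M \<sigma>" "\<forall>(a, b)\<in>R. \<sigma> a = b" using homogeneous by blast
  have \<sigma>g: "\<sigma> (g i) = ?val i" if "i \<in> ?I" for i using \<sigma>(2) that by (auto simp: R_def)
  have "\<forall>b\<in>B. \<sigma> b = b"
  proof
    fix b assume b: "b \<in> B"
    show "\<sigma> b = b" using \<sigma>g[of "Inr b"] g(2)[OF b] b by simp
  qed
  moreover have "\<sigma> ` g ` Inl ` A = A"
  proof -
    have "\<sigma> (g (Inl a)) = a" if "a \<in> A" for a using \<sigma>g[of "Inl a"] that by simp
    then show ?thesis by (simp add: image_image)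
  qed
  ultimately show ?thesis using \<sigma>(1) unfolding equiv_over_def by blast
qed

lemma small_finite: "finite X \<Longrightarrow> X \<subseteq> univ M \<Longrightarrow> small M X"
  by (simp add: small_def)

lemma tuple_of_sort_nth:
  assumes "tuple_of_sort M vs as"
  shows "length as = length vs" "set as \<subseteq> univ M" "\<And>k. k < length vs \<Longrightarrow> sort_of M (as ! k) = snd (vs ! k)"
proof -
  have eq: "map (sort_of M) as = map snd vs" using assms by (simp add: tuple_of_sort_def)
  show len: "length as = length vs" using eq by (metis length_map)
  show "sort_of M (as ! k) = snd (vs ! k)" if "k < length vs" for k using eq len that by (metis nth_map)
  show "set as \<subseteq> univ M" using assms by (simp add: tuple_of_sort_def)
qed

text \<open>If the copy were dependent, strong finite character would supply a formula true of a
  tuple from it. Read as a predicate of the indices of that tuple, its negation is one of the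
  conditions satisfied by \<open>g\<close>.\<close>

lemma ind_conds_realized:
  assumes mono: "monotonicity M ind" and sfc: "strong_finite_character L M ind"
    and small: "small M A" "small M B" "small M C"
    and g: "g \<in> assigns sort2 (Inl ` A \<union> Inr ` (B \<union> C))" "\<And>d. d \<in> B \<union> C \<Longrightarrow> g (Inr d) = d"
    and conds: "\<forall>P\<in>ind_conds ind A C B. P g"
  shows "ind (g ` Inl ` A) C B"
proof (rule ccontr)
  let ?A = "g ` Inl ` A"
  assume dep: "\<not> ind ?A C B"
  have gA: "g (Inl a) \<in> univ M" "sort_of M (g (Inl a)) = sort_of M a" if "a \<in> A" for a
    using g(1) that by (auto simp: assigns_def)
  have "small M ?A" using small(1) gA few_image[OF few_image, of A g Inl] by (auto simp: small_iff)
  then have "small M ?A \<and> small M B \<and> small M C \<and> \<not> ind ?A C B" using small dep by blast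
  from sfc[unfolded strong_finite_character_def, rule_format, OF this]
  obtain as bs cs xs ys zs \<phi> where sub: "set as \<subseteq> ?A" "set bs \<subseteq> B" "set cs \<subseteq> C"
    and tup: "tuple_of_sort M xs as" "tuple_of_sort M ys bs" "tuple_of_sort M zs cs"
    and \<phi>: "wf_fm L \<phi>" "distinct (xs @ ys @ zs)" "fv \<phi> \<subseteq> set (xs @ ys @ zs)"
    and holds: "holds M \<phi> (xs @ ys @ zs) (as @ bs @ cs)"
    and imp: "\<And>as'. tuple_of_sort M xs as' \<Longrightarrow> holds M \<phi> (xs @ ys @ zs) (as' @ bs @ cs) \<Longrightarrow>
      \<not> ind (set as') C (set bs)"
    by (elim exE conjE) blast
  have "\<forall>a\<in>set as. \<exists>i. i \<in> Inl ` A \<and> g i = a" using sub(1) by blast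
  then obtain k where k: "\<And>a. a \<in> set as \<Longrightarrow> k a \<in> Inl ` A \<and> g (k a) = a" by metis
  have sortk: "sort2 (k a) = sort_of M a" if "a \<in> set as" for a using k[OF that] gA(2) by auto
  define vs where "vs = xs @ ys @ zs"
  define js where "js = map k as @ map Inr bs @ map Inr cs"
  \<comment> \<open>The variables \<open>vs\<close> are distinct but the indices \<open>js\<close>
    may repeat, as entries of the tuples may; hence \<open>e\<close> goes from variables to
    indices.\<close>
  define e where "e v = the (map_of (zip vs js) v)" for v
  have len: "length js = length vs" using tup by (simp add: js_def vs_def tuple_of_sort_nth(1))
  have "map sort2 js = map (sort_of M) (as @ bs @ cs)" using sortk by (simp add: js_def)
  also have "\<dots> = map snd vs" using tup by (simp add: tuple_of_sort_def vs_def)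
  finally have "sort2 (js ! n) = snd (vs ! n)" if "n < length vs" for n
    using that len by (metis nth_map)
  moreover have e: "e (vs ! n) = js ! n" if "n < length vs" for n
    using map_of_zip_nth[of vs js n] \<phi>(2) len that by (simp add: e_def vs_def)
  moreover have fv: "\<exists>n<length vs. v = vs ! n" if "v \<in> fv \<phi>" for v
    using \<phi>(3) that unfolding vs_def in_set_conv_nth by (metis in_set_conv_nth subsetD)
  ultimately have ev: "e v \<in> set js \<and> sort2 (e v) = snd v" if "v \<in> fv \<phi>" for v
    using that len by (metis nth_mem)
  have sat: "sat M (h \<circ> e) \<phi> \<longleftrightarrow> holds M \<phi> vs (map h js)" for h
    unfolding holds_def
  proof (rule sat_cong)
    fix v assume "v \<in> fv \<phi>"
    then obtain n where n: "n < length vs" "v = vs ! n" using fv by blast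
    then show "(h \<circ> e) v = the (map_of (zip vs (map h js)) v)"
      using map_of_zip_nth[of vs "map h js" n] e[OF n(1)] \<phi>(2) len by (simp add: vs_def)
  qed
  have "(\<lambda>h. sat M (h \<circ> e) (Neg \<phi>)) \<in> ind_conds ind A C B"
    unfolding ind_conds_def
  proof (intro CollectI exI[of _ "set js"] conjI ballI impI)
    show "set js \<subseteq> Inl ` A \<union> Inr ` (B \<union> C)" using k sub(2,3) by (auto simp: js_def)
    show "definable sort2 (set js) (\<lambda>h. sat M (h \<circ> e) (Neg \<phi>))"
      using ev \<phi>(1) by (intro definable_sat) auto
    fix h assume h: "h \<in> assigns sort2 (set js)"
      and *: "(\<forall>d\<in>B \<union> C. h (Inr d) = d) \<and> \<not> sat M (h \<circ> e) (Neg \<phi>)"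
    let ?as = "map (h \<circ> k) as"
    have "map h (map Inr bs) = bs" "map h (map Inr cs) = cs"
      using * sub(2,3) by (auto intro!: map_idI)
    then have "map h js = ?as @ bs @ cs" by (simp add: js_def)
    moreover have "sat M (h \<circ> e) \<phi>" using * by simp
    ultimately have "holds M \<phi> (xs @ ys @ zs) (?as @ bs @ cs)" using sat vs_def by simp
    moreover have hk: "h (k a) \<in> univ M \<and> sort_of M (h (k a)) = sort_of M a" if "a \<in> set as" for a
      using h that sortk by (auto simp: assigns_def js_def)
    have "map (sort_of M) ?as = map (sort_of M) as" using hk by simp
    then have "tuple_of_sort M xs ?as" using tup(1) hk unfolding tuple_of_sort_def by auto
    ultimately have "\<not> ind (set ?as) C (set bs)" using imp by blast
    \<comment> \<open>The formula promises dependence of \<open>?as\<close> from \<open>bs\<close>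
      only; monotonicity carries it to the larger sets on both sides.\<close>
    moreover have "set ?as \<subseteq> h ` (set js \<inter> range Inl)" using k by (force simp: js_def)
    moreover have "small M (h ` (set js \<inter> range Inl))"
      using h by (intro small_finite) (auto simp: assigns_def)
    ultimately show "\<not> ind (h ` (set js \<inter> range Inl)) C B"
      using mono small(2,3) sub(2) unfolding monotonicity_def by blast
  qed simp
  from bspec[OF conds this] have "\<not> holds M \<phi> vs (map g js)" using sat by simp
  moreover have "map g js = as @ bs @ cs"
  proof -
    have "map g (map k as) = as" "map g (map Inr bs) = bs" "map g (map Inr cs) = cs"
      using k g(2) sub(2,3) by (auto intro!: map_idI)
    then show ?thesis by (simp add: js_def)
  qed
  ultimately show False using holds vs_def by simp
qed

text \<open>Compactness read contrapositively, with the values at all parameter indices prescribed: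
  parameters are fixed coordinates of an assignment rather than constants of an expanded language. A
  solution of all conditions would be a copy of \<open>A\<close> excluded by
  \<open>dep\<close>.\<close>

lemma contradictory_conds:
  assumes mono: "monotonicity M ind" and sfc: "strong_finite_character L M ind"
    and small: "small M A" "small M B" "small M C" "small M B'" and B: "B \<subseteq> B'"
    and dep: "\<And>A'. small M A' \<Longrightarrow> equiv_over L M (B \<union> C) A' A \<Longrightarrow> \<not> ind A' C B'"
  shows "\<exists>\<Gamma>. finite \<Gamma> \<and> \<Gamma> \<subseteq> type_conds A (B \<union> C) \<union> ind_conds ind A C B' \<and>
    (\<forall>g\<in>assigns sort2 (Inl ` A \<union> Inr ` (B' \<union> C)). (\<forall>d\<in>B' \<union> C. g (Inr d) = d) \<longrightarrow> \<not> (\<forall>P\<in>\<Gamma>. P g))"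
proof (rule ccontr)
  let ?I = "Inl ` A \<union> Inr ` (B' \<union> C) :: ('a + 'a) set" and ?D = "Inr ` (B' \<union> C) :: ('a + 'a) set"
  let ?\<Gamma> = "type_conds A (B \<union> C) \<union> ind_conds ind A C B'"
  assume contr: "\<nexists>\<Gamma>. finite \<Gamma> \<and> \<Gamma> \<subseteq> ?\<Gamma> \<and>
    (\<forall>g\<in>assigns sort2 ?I. (\<forall>d\<in>B' \<union> C. g (Inr d) = d) \<longrightarrow> \<not> (\<forall>P\<in>\<Gamma>. P g))"
  have few: "few A" "few B" "few C" "few B'"
    and univ: "A \<subseteq> univ M" "B \<subseteq> univ M" "C \<subseteq> univ M" "B' \<subseteq> univ M"
    using small by (auto simp: small_iff)
  have fewI: "few ?I" using few by (intro few_image_Plus few_Un)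
  have sorts: "sort2 ` ?I \<subseteq> sorts L" using univ sort_of_in_sorts by (auto simp: subset_iff)
  have supp: "\<exists>J. finite J \<and> J \<subseteq> ?I \<and> definable sort2 J P" if "P \<in> ?\<Gamma>" for P
    using that
  proof
    assume "P \<in> type_conds A (B \<union> C)"
    then obtain J where J: "finite J" "J \<subseteq> Inl ` A \<union> Inr ` (B \<union> C)" "definable sort2 J P"
      unfolding type_conds_def mem_Collect_eq by (elim exE conjE)
    moreover have "J \<subseteq> ?I" using J(2) B by blast
    ultimately show ?thesis by (intro exI[of _ J] conjI)
  next
    assume "P \<in> ind_conds ind A C B'"
    then obtain J where "finite J" "J \<subseteq> ?I" "definable sort2 J P"
      unfolding ind_conds_def mem_Collect_eq by (elim exE conjE)
    then show ?thesis by (intro exI[of _ J] conjI)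
  qed
  have "\<exists>g\<in>assigns sort2 ?I. (\<forall>i\<in>?D. g i = case_sum id id i) \<and> (\<forall>P\<in>?\<Gamma>. P g)"
  proof (rule compactness[OF fewI sorts supp])
    fix \<Gamma>0 assume "finite \<Gamma>0" "\<Gamma>0 \<subseteq> ?\<Gamma>"
    show "\<exists>g\<in>assigns sort2 ?I. (\<forall>i\<in>?D. g i = case_sum id id i) \<and> (\<forall>P\<in>\<Gamma>0. P g)" (is ?goal)
    proof (rule ccontr)
      assume neg: "\<not> ?goal"
      have "\<forall>g\<in>assigns sort2 ?I. (\<forall>d\<in>B' \<union> C. g (Inr d) = d) \<longrightarrow> \<not> (\<forall>P\<in>\<Gamma>0. P g)"
      proof (intro ballI impI notI)
        fix g assume g: "g \<in> assigns sort2 ?I" "\<forall>d\<in>B' \<union> C. g (Inr d) = d" "\<forall>P\<in>\<Gamma>0. P g"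
        have "\<forall>i\<in>?D. g i = case_sum id id i" using g(2) by auto
        with g(1,3) have ?goal by (intro bexI[of _ g] conjI)
        with neg show False ..
      qed
      with \<open>finite \<Gamma>0\<close> \<open>\<Gamma>0 \<subseteq> ?\<Gamma>\<close> have "\<exists>\<Gamma>. finite \<Gamma> \<and> \<Gamma> \<subseteq> ?\<Gamma> \<and>
          (\<forall>g\<in>assigns sort2 ?I. (\<forall>d\<in>B' \<union> C. g (Inr d) = d) \<longrightarrow> \<not> (\<forall>P\<in>\<Gamma>. P g))"
        by (intro exI[of _ \<Gamma>0] conjI)
      with contr show False ..
    qed
  qed (assumption | rule Un_upper2)+
  then obtain g where g: "g \<in> assigns sort2 ?I" "\<forall>i\<in>?D. g i = case_sum id id i" "\<forall>P\<in>?\<Gamma>. P g"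
    by (elim bexE conjE)
  have gD: "g (Inr d) = d" if "d \<in> B' \<union> C" for d using g(2) that by simp
  have "g \<in> assigns sort2 (Inl ` A \<union> Inr ` (B \<union> C))"
    by (rule assigns_mono[OF g(1)]) (use B in blast)
  then have "equiv_over L M (B \<union> C) (g ` Inl ` A) A"
    using few univ gD B g(3) by (intro type_conds_realized ballI) (auto simp: small_iff intro: few_Un)
  moreover have "small M (g ` Inl ` A)"
    using g(1) few_image[OF few_image[OF few(1)]] by (auto simp: small_iff assigns_def)
  moreover have "ind (g ` Inl ` A) C B'"
    using g(3) by (intro ind_conds_realized[OF mono sfc small(1,4,3) g(1) gD]) auto
  ultimately show False using dep by blast
qed

end

section \<open>The formula that forces dependence for the derived relation\<close>

theorem lemma2p2:
  fixes L :: "('s, 'f, 'p) lang"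
    and T :: "('s, 'f, 'p) fm set"
    and M :: "('s, 'f, 'p, 'a) struct"
    and ind :: "'a set \<Rightarrow> 'a set \<Rightarrow> 'a set \<Rightarrow> bool"
  assumes "is_lang L"
    and "is_theory L T" and "consistent L T" and "complete L T"
    and "is_model L M T" and "saturated L M"
    and "invariance L M ind"
    and "monotonicity M ind"
    and "strong_finite_character L M ind"
  shows "strong_finite_character L M (star L M ind)"
  unfolding strong_finite_character_def
proof (intro allI impI)
  interpret saturated_struct L M
    using assms by unfold_locales (auto simp: is_model_def)
  note mono = \<open>monotonicity M ind\<close> and sfc = \<open>strong_finite_character L M ind\<close>
  fix A B C
  assume ABC: "small M A \<and> small M B \<and> small M C \<and> \<not> star L M ind A C B"
  then have small: "small M A" "small M B" "small M C" by blast+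
  from ABC obtain B' where B': "small M B'" "B \<subseteq> B'"
    and dep: "\<And>A'. small M A' \<Longrightarrow> equiv_over L M (B \<union> C) A' A \<Longrightarrow> \<not> ind A' C B'"
    unfolding star_def by blast
  have univ: "A \<subseteq> univ M" "B \<subseteq> univ M" "C \<subseteq> univ M" "B' \<subseteq> univ M"
    using small B'(1) by (auto simp: small_def)
  let ?I = "Inl ` A \<union> Inr ` (B' \<union> C) :: ('a + 'a) set" and ?val = "case_sum id id :: 'a + 'a \<Rightarrow> 'a"
  have "\<exists>\<Gamma>. finite \<Gamma> \<and> \<Gamma> \<subseteq> type_conds A (B \<union> C) \<union> ind_conds ind A C B' \<and>
    (\<forall>g\<in>assigns sort2 ?I. (\<forall>d\<in>B' \<union> C. g (Inr d) = d) \<longrightarrow> \<not> (\<forall>P\<in>\<Gamma>. P g))"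
    using mono sfc small B' dep by (rule contradictory_conds)
  then obtain \<Gamma> where \<Gamma>: "finite \<Gamma>" "\<Gamma> \<subseteq> type_conds A (B \<union> C) \<union> ind_conds ind A C B'"
    and contr: "\<And>g. g \<in> assigns sort2 ?I \<Longrightarrow> \<forall>d\<in>B' \<union> C. g (Inr d) = d \<Longrightarrow> \<not> (\<forall>P\<in>\<Gamma>. P g)"
    by (elim exE conjE) blast
  \<comment> \<open>The conjunction of \<open>\<Gamma>1\<close> becomes the required formula. Any
    other condition in \<open>\<Gamma>\<close> forces dependence when it fails.\<close>
  define \<Gamma>1 where "\<Gamma>1 = \<Gamma> \<inter> type_conds A (B \<union> C)"
  have fin\<Gamma>1: "finite \<Gamma>1" using \<Gamma>(1) by (simp add: \<Gamma>1_def)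
  have supp: "\<exists>J. finite J \<and> J \<subseteq> Inl ` A \<union> Inr ` (B \<union> C) \<and> definable sort2 J P" if "P \<in> \<Gamma>1" for P
    using that unfolding \<Gamma>1_def type_conds_def by blast
  have "\<exists>J. finite J \<and> J \<subseteq> Inl ` A \<union> Inr ` (B \<union> C) \<and> (\<forall>P\<in>\<Gamma>1. definable sort2 J P)"
    by (rule common_support[OF supp fin\<Gamma>1])
  then obtain J1 where J1: "finite J1"
    "J1 \<subseteq> Inl ` A \<union> Inr ` (B \<union> C)" "\<forall>P\<in>\<Gamma>1. definable sort2 J1 P" by (elim exE conjE)
  have "\<forall>P\<in>\<Gamma> - \<Gamma>1. \<exists>J. finite J \<and> J \<subseteq> ?I \<and>
    (\<forall>g\<in>assigns sort2 J. (\<forall>d\<in>B' \<union> C. g (Inr d) = d) \<and> \<not> P g \<longrightarrow> \<not> ind (g ` (J \<inter> range Inl)) C B')"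
  proof
    fix P assume "P \<in> \<Gamma> - \<Gamma>1"
    then have "P \<in> ind_conds ind A C B'" using \<Gamma>(2) by (auto simp: \<Gamma>1_def)
    then obtain J where "finite J" "J \<subseteq> ?I" "\<forall>g\<in>assigns sort2 J. (\<forall>d\<in>B' \<union> C. g (Inr d) = d) \<and> \<not> P g \<longrightarrow>
        \<not> ind (g ` (J \<inter> range Inl)) C B'"
      unfolding ind_conds_def mem_Collect_eq by (elim exE conjE)
    then show "\<exists>J. finite J \<and> J \<subseteq> ?I \<and> (\<forall>g\<in>assigns sort2 J. (\<forall>d\<in>B' \<union> C. g (Inr d) = d) \<and> \<not> P g \<longrightarrow>
        \<not> ind (g ` (J \<inter> range Inl)) C B')" by (intro exI[of _ J] conjI)
  qed
  from bchoice[OF this] obtain J2 where J2: "\<forall>P\<in>\<Gamma> - \<Gamma>1. finite (J2 P) \<and> J2 P \<subseteq> ?I \<and>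
    (\<forall>g\<in>assigns sort2 (J2 P). (\<forall>d\<in>B' \<union> C. g (Inr d) = d) \<and> \<not> P g \<longrightarrow>
      \<not> ind (g ` (J2 P \<inter> range Inl)) C B')" ..
  \<comment> \<open>The supports of the dependence conditions are included so that \<open>as\<close>
    lists every element of \<open>A\<close> they speak about, even one on which
    \<open>\<Gamma>1\<close> does not depend.\<close>
  define K where "K = J1 \<union> \<Union> (J2 ` (\<Gamma> - \<Gamma>1))"
  have J2fin: "finite (J2 P)" "J2 P \<subseteq> ?I" if "P \<in> \<Gamma> - \<Gamma>1" for P using J2 that by simp_all
  have "J1 \<subseteq> ?I" using J1(2) B'(2) by blast
  then have K: "finite K" "K \<subseteq> ?I" using J1(1) J2fin \<Gamma>(1) unfolding K_def by (simp, blast)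
  have fin: "finite (Inl -` K)" "finite (Inr -` J1)" using K(1) J1(1) by (simp_all add: finite_vimageI)
  obtain as where as: "set as = Inl -` K" "distinct as"
    using finite_distinct_list[OF fin(1)] by blast
  \<comment> \<open>Parameters in \<open>B \<inter> C\<close> are listed in \<open>bs\<close> only,
    which keeps the indices \<open>js\<close> and so the variables distinct.\<close>
  obtain bs where bs: "set bs = B \<inter> Inr -` J1" "distinct bs"
    using finite_distinct_list[of "B \<inter> Inr -` J1"] fin(2) by blast
  obtain cs where cs: "set cs = (C - B) \<inter> Inr -` J1" "distinct cs"
    using finite_distinct_list[of "(C - B) \<inter> Inr -` J1"] fin(2) by blast
  define js :: "('a + 'a) list" where "js = map Inl as @ map Inr bs @ map Inr cs"
  have asA: "set as \<subseteq> A" using as K(2) by auto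
  have js: "distinct js" using as bs cs by (auto simp: js_def distinct_map)
  have set_js: "set js = Inl ` set as \<union> Inr ` set bs \<union> Inr ` set cs" by (simp add: js_def Un_assoc)
  have J1js: "J1 \<subseteq> set js"
  proof
    fix j assume j: "j \<in> J1"
    show "j \<in> set js"
    proof (cases j)
      case (Inl a)
      then have "a \<in> set as" using j as(1) by (simp add: K_def)
      then show ?thesis using Inl set_js by blast
    next
      case (Inr d)
      then have "d \<in> B \<union> C" using j J1(2) by blast
      then have "d \<in> set bs \<or> d \<in> set cs" using j Inr bs(1) cs(1) by auto
      then show ?thesis using Inr set_js by blast
    qed
  qed
  have jsI: "set js \<subseteq> ?I" using asA bs(1) cs(1) B'(2) unfolding set_js by blast
  define P0 where "P0 g \<longleftrightarrow> (\<forall>P\<in>\<Gamma>1. P g)" for g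
  have "definable sort2 J1 P0"
    unfolding P0_def[abs_def] using J1(3) by (intro definable_Ball[OF fin\<Gamma>1]) simp
  then have P0: "definable sort2 (set js) P0" using definable_mono J1js by blast
  obtain w :: "'a + 'a \<Rightarrow> 's vbl" where w: "inj_on w (set js)" "\<And>j. snd (w j) = sort2 j"
    using ex_vars[of "set js" sort2] by auto
  obtain \<phi> where \<phi>: "wf_fm L \<phi>" "fv \<phi> \<subseteq> w ` set js"
    "\<And>g h. g \<in> assigns sort2 (set js) \<Longrightarrow> (\<And>j. j \<in> set js \<Longrightarrow> h (w j) = g j) \<Longrightarrow> P0 g \<longleftrightarrow> sat M h \<phi>"
    using definableE[OF P0 w] by metis
  define xs ys zs where xyz: "xs = map (w \<circ> Inl) as" "ys = map (w \<circ> Inr) bs" "zs = map (w \<circ> Inr) cs"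
  have vs: "xs @ ys @ zs = map w js" by (simp add: xyz js_def)
  have dist: "distinct (map w js)" using js w(1) by (simp add: distinct_map)
  have holds: "holds M \<phi> (map w js) (map g js) \<longleftrightarrow> P0 g" if "g \<in> assigns sort2 (set js)" for g
    unfolding holds_def
  proof (rule \<phi>(3)[OF that, symmetric])
    fix j assume "j \<in> set js"
    then obtain n where n: "n < length js" "j = js ! n" by (metis in_set_conv_nth)
    then show "the (map_of (zip (map w js) (map g js)) (w j)) = g j"
      using map_of_zip_nth[of "map w js" "map g js" n] dist by simp
  qed
  have "set as \<subseteq> A \<and> set bs \<subseteq> B \<and> set cs \<subseteq> C \<and>
    tuple_of_sort M xs as \<and> tuple_of_sort M ys bs \<and> tuple_of_sort M zs cs \<and>
    wf_fm L \<phi> \<and> distinct (xs @ ys @ zs) \<and> fv \<phi> \<subseteq> set (xs @ ys @ zs) \<and>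
    holds M \<phi> (xs @ ys @ zs) (as @ bs @ cs) \<and>
    (\<forall>as'. tuple_of_sort M xs as' \<and> holds M \<phi> (xs @ ys @ zs) (as' @ bs @ cs) \<longrightarrow>
      \<not> star L M ind (set as') C (set bs))"
  proof (intro conjI allI impI)
    show "set as \<subseteq> A" "set bs \<subseteq> B" "set cs \<subseteq> C" using asA bs(1) cs(1) by auto
    then show "tuple_of_sort M xs as" "tuple_of_sort M ys bs" "tuple_of_sort M zs cs"
      using univ w(2) by (auto simp: tuple_of_sort_def xyz)
    show "wf_fm L \<phi>" "distinct (xs @ ys @ zs)" "fv \<phi> \<subseteq> set (xs @ ys @ zs)"
      using \<phi>(1,2) dist unfolding vs by simp_all
    have "?val \<in> assigns sort2 ?I" using univ by (auto simp: assigns_def)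
    then have "?val \<in> assigns sort2 (set js)" using jsI by (rule assigns_mono)
    moreover have "P0 ?val" by (auto simp: P0_def \<Gamma>1_def type_conds_def)
    moreover have "map ?val js = as @ bs @ cs" by (simp add: js_def comp_def)
    ultimately show "holds M \<phi> (xs @ ys @ zs) (as @ bs @ cs)" using holds[of ?val] vs by simp
    fix as' assume as': "tuple_of_sort M xs as' \<and> holds M \<phi> (xs @ ys @ zs) (as' @ bs @ cs)"
    show "\<not> star L M ind (set as') C (set bs)"
    proof
      assume "star L M ind (set as') C (set bs)"
      \<comment> \<open>Being a superset of \<open>bs\<close>, the set \<open>B'\<close> that
        witnessed the dependence of \<open>A\<close> may be used to test \<open>as'\<close> as well.
        The resulting automorphism fixes \<open>bs\<close> and \<open>C\<close>, hence all
        parameters of \<open>\<phi>\<close>.\<close>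
      moreover have "set bs \<subseteq> B'" using bs(1) B'(2) by blast
      ultimately obtain A' where A': "small M A'" "equiv_over L M (set bs \<union> C) A' (set as')" "ind A' C B'"
        unfolding star_def using B'(1) by blast
      then obtain \<sigma> where \<sigma>: "automorphism L M \<sigma>" "\<forall>d\<in>set bs \<union> C. \<sigma> d = d" "\<sigma> ` A' = set as'"
        unfolding equiv_over_def by blast
      have A'univ: "A' \<subseteq> univ M" using A'(1) by (simp add: small_def)
      have \<sigma>s: "sort_of M (\<sigma> a) = sort_of M a" if "a \<in> A'" for a
        using \<sigma>(1) A'univ that by (auto simp: automorphism_def)
      \<comment> \<open>The equivalence relates only the sets \<open>A'\<close> and
        \<open>set as'\<close>; pulling the entries back one by one recovers a tuple in
        \<open>A'\<close>.\<close>
      define as'' where "as'' = map (inv_into A' \<sigma>) as'"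
      have as''A: "set as'' \<subseteq> A'" using \<sigma>(3) by (auto simp: as''_def intro: inv_into_into)
      have \<sigma>as'': "map \<sigma> as'' = as'" using \<sigma>(3) by (auto simp: as''_def f_inv_into_f intro!: map_idI)
      have len: "length as'' = length as"
        using tuple_of_sort_nth(1)[of xs as'] as' by (simp add: as''_def xyz)
      \<comment> \<open>The contradiction concerns assignments of all of \<open>?I\<close>. Elements
        of \<open>A\<close> outside \<open>as\<close> keep their own values, which have the right
        sorts and are not seen by any condition used below.\<close>
      define g where "g = case_sum (\<lambda>a. if a \<in> set as then the (map_of (zip as as'') a) else a) id"
      have g_nth: "g (Inl (as ! n)) = as'' ! n" if "n < length as" for n
        using that map_of_zip_nth[of as as'' n] as(2) len by (simp add: g_def)
      have gD: "g (Inr d) = d" for d by (simp add: g_def)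
      have g_as: "g (Inl a) \<in> A' \<and> sort_of M (g (Inl a)) = sort_of M a" if "a \<in> set as" for a
      proof -
        from that obtain n where n: "n < length as" "a = as ! n" by (metis in_set_conv_nth)
        have mem: "as'' ! n \<in> A'" using as''A n(1) len by (metis nth_mem subsetD)
        have "sort_of M (as'' ! n) = sort_of M (as' ! n)"
          using \<sigma>s[OF mem] \<sigma>as'' n(1) len by (metis nth_map)
        also have "\<dots> = snd (xs ! n)" using tuple_of_sort_nth(3)[of xs as' n] as' n(1) by (simp add: xyz)
        also have "\<dots> = sort_of M a" using n w(2) by (simp add: xyz)
        finally show ?thesis using g_nth n mem by simp
      qed
      have gI: "g \<in> assigns sort2 ?I"
        unfolding assigns_def
      proof (intro CollectI ballI)
        fix i assume i: "i \<in> ?I"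
        show "g i \<in> univ M \<and> sort_of M (g i) = sort2 i"
        proof (cases i)
          case (Inl a)
          then have "a \<in> A" using i by auto
          then show ?thesis using g_as[of a] A'univ univ(1) Inl
            by (cases "a \<in> set as") (auto simp: g_def)
        next
          case (Inr d)
          then have "d \<in> B' \<union> C" using i by auto
          then show ?thesis using gD[of d] univ Inr by auto
        qed
      qed
      then have gjs: "g \<in> assigns sort2 (set js)" using assigns_mono jsI by blast
      have "map (\<sigma> \<circ> g) js = as' @ bs @ cs"
      proof -
        have "map (g \<circ> Inl) as = as''" using len g_nth by (auto intro: nth_equalityI)
        then have "map (\<sigma> \<circ> g) (map Inl as) = as'" using \<sigma>as'' by (metis map_map)
        moreover have "map (\<sigma> \<circ> g) (map Inr bs) = bs" "map (\<sigma> \<circ> g) (map Inr cs) = cs"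
          using \<sigma>(2) gD cs(1) by (auto intro!: map_idI)
        ultimately show ?thesis by (simp add: js_def del: map_map)
      qed
      moreover have "\<sigma> \<circ> g \<in> assigns sort2 (set js)"
        using gjs bij_betwE[of \<sigma> "univ M" "univ M"] \<sigma>(1) by (auto simp: assigns_def automorphism_def)
      ultimately have "P0 (\<sigma> \<circ> g)" using holds[of "\<sigma> \<circ> g"] as' vs by simp
      \<comment> \<open>The formula holds of \<open>as'\<close>, so it holds of its preimage in
        \<open>A'\<close>. As the conditions contradict each other, one outside
        \<open>\<Gamma>1\<close> fails at \<open>g\<close>, and its failure makes a finite subset of
        \<open>A'\<close> dependent from \<open>B'\<close> over \<open>C\<close>.\<close>
      then have "P0 g" using definable_automorphism[OF \<sigma>(1) _ P0 gjs] by simp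
      moreover obtain P where P: "P \<in> \<Gamma>" "\<not> P g" using contr[OF gI] gD by blast
      ultimately have "P \<in> \<Gamma> - \<Gamma>1" by (auto simp: P0_def)
      then have "\<not> ind (g ` (J2 P \<inter> range Inl)) C B'"
        using J2 P(2) gD assigns_mono[OF gI] by blast
      moreover have "g ` (J2 P \<inter> range Inl) \<subseteq> A'"
        using g_as as(1) \<open>P \<in> \<Gamma> - \<Gamma>1\<close> by (auto simp: K_def)
      ultimately show False
        using mono A'(1,3) B'(1) small(3) unfolding monotonicity_def by blast
    qed
  qed
  then show "\<exists>as bs cs xs ys zs \<phi>. set as \<subseteq> A \<and> set bs \<subseteq> B \<and> set cs \<subseteq> C \<and>
    tuple_of_sort M xs as \<and> tuple_of_sort M ys bs \<and> tuple_of_sort M zs cs \<and>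
    wf_fm L \<phi> \<and> distinct (xs @ ys @ zs) \<and> fv \<phi> \<subseteq> set (xs @ ys @ zs) \<and>
    holds M \<phi> (xs @ ys @ zs) (as @ bs @ cs) \<and>
    (\<forall>as'. tuple_of_sort M xs as' \<and> holds M \<phi> (xs @ ys @ zs) (as' @ bs @ cs) \<longrightarrow>
      \<not> star L M ind (set as') C (set bs))"
    by (intro exI)
qed

end
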